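(* $i(3,\infty)\le 0.454$.
   Context: For a graph $G$, $\alpha(G)$ is its independence number (maximum size of a set of pairwise non-adjacent vertices) and $i(G)=\alpha(G)/|V(G)|$ is its independence ratio. For positive integers $r,g$, $i(r,g)$ denotes the infimum of $i(G)$ over all $r$-regular (simple) graphs $G$ of girth at least $g$, and $i(r,\infty)=\lim_{g\to\infty} i(r,g)$. *)

theory Defs
  imports Complex_Main
begin

text \<open>Finite simple graphs, with vertices drawn from nat (every finite graph is
isomorphic to one of these, so the infimum is unaffected). A graph is a pair
(V, E) with E a symmetric irreflexive adjacency relation on V.\<close>

definition simple_graph :: "nat set \<Rightarrow> (nat \<Rightarrow> nat \<Rightarrow> bool) \<Rightarrow> bool" where
  "simple_graph V E \<longleftrightarrow> finite V \<and> V \<noteq> {} \<and>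
     (\<forall>x y. E x y \<longrightarrow> x \<in> V \<and> y \<in> V) \<and>
     (\<forall>x y. E x y \<longrightarrow> E y x) \<and> (\<forall>x. \<not> E x x)"

definition regular :: "nat \<Rightarrow> nat set \<Rightarrow> (nat \<Rightarrow> nat \<Rightarrow> bool) \<Rightarrow> bool" where
  "regular r V E \<longleftrightarrow> (\<forall>v\<in>V. card {u \<in> V. E v u} = r)"

definition is_cycle :: "nat set \<Rightarrow> (nat \<Rightarrow> nat \<Rightarrow> bool) \<Rightarrow> nat list \<Rightarrow> bool" where
  "is_cycle V E cs \<longleftrightarrow> length cs \<ge> 3 \<and> distinct cs \<and> set cs \<subseteq> V \<and>
     (\<forall>i < length cs. E (cs ! i) (cs ! ((i + 1) mod length cs)))"

definition girth_at_least :: "nat set \<Rightarrow> (nat \<Rightarrow> nat \<Rightarrow> bool) \<Rightarrow> nat \<Rightarrow> bool" where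
  "girth_at_least V E g \<longleftrightarrow> (\<forall>cs. is_cycle V E cs \<longrightarrow> length cs \<ge> g)"

definition independent_set :: "nat set \<Rightarrow> (nat \<Rightarrow> nat \<Rightarrow> bool) \<Rightarrow> nat set \<Rightarrow> bool" where
  "independent_set V E S \<longleftrightarrow> S \<subseteq> V \<and> (\<forall>x\<in>S. \<forall>y\<in>S. \<not> E x y)"

definition independence_number :: "nat set \<Rightarrow> (nat \<Rightarrow> nat \<Rightarrow> bool) \<Rightarrow> nat" where
  "independence_number V E = Max (card ` {S. independent_set V E S})"

definition independence_ratio :: "nat set \<Rightarrow> (nat \<Rightarrow> nat \<Rightarrow> bool) \<Rightarrow> real" where
  "independence_ratio V E = real (independence_number V E) / real (card V)"

definition i_rg :: "nat \<Rightarrow> nat \<Rightarrow> real" where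
  "i_rg r g = Inf {independence_ratio V E | V E.
      simple_graph V E \<and> regular r V E \<and> girth_at_least V E g}"

definition i_inf :: "nat \<Rightarrow> real" where
  "i_inf r = lim (\<lambda>g. i_rg r g)"

end

theory Submission
  imports Defs "HOL-Combinatorics.Permutations"
begin

text \<open>
  This is the zero-temperature interpolation method of statistical physics (the one-step replica
  symmetry breaking bound), carried out by counting. Split each of the \<open>n\<close> vertices into \<open>d\<close>
  half-edges, and add random edges between half-edges one at a time. Adding an edge \<open>uv\<close> lowers the
  independence number by one exactly if \<open>u\<close> and \<open>v\<close> are both frozen, that is, in every maximum
  independent set; a ``warning'' at \<open>v\<close> (the constraint that \<open>v\<close> be unused) lowers it by one exactly
  if \<open>v\<close> is frozen. Let \<open>f\<close> be the fraction of free half-edges at frozen vertices, weight a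
  configuration by \<open>\<lambda>\<close> to the independence number, and put \<open>c = 1 - 1/\<lambda>\<close>. An edge multiplies the
  expected weight by \<open>1 - c f\<^sup>2\<close> and a warning placed with probability \<open>q\<close> by \<open>1 - c q f\<close>. As
  \<open>(f - q)\<^sup>2 \<ge> 0\<close>, each edge may be traded for two warnings at the cost of a factor \<open>1 / (1 - c q\<^sup>2)\<close>.
  With warnings only, the vertices are independent and the total weight is
  \<open>(1 + (\<lambda> - 1) (1 - q)\<^sup>d)\<^sup>n\<close>.

  Short cycles never arise, because edges between nearby vertices are simply not added: as long as
  linearly many half-edges are free, this excludes a negligible fraction of the choices. Finally,
  copies of the resulting graph, one for each permutation of a finite set, are joined at their free
  half-edges to give a regular graph; this keeps the girth and does not raise the independence
  ratio. For \<open>d = 3\<close>, \<open>\<lambda> = 3\<close>, \<open>q = 1/2\<close> the bound is \<open>ln 2.7 / (2 ln 3) = 0.45205...\<close>.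
\<close>

section \<open>Girth and non-backtracking walks\<close>

text \<open>Walks are listed with their current endpoint first. The condition \<open>c \<noteq> a\<close> forbids backtracking.\<close>

fun nbw :: "('a \<Rightarrow> 'a \<Rightarrow> bool) \<Rightarrow> 'a list \<Rightarrow> bool" where
  "nbw E [] = False"
| "nbw E [x] = True"
| "nbw E [b, a] = E a b"
| "nbw E (c # b # a # xs) = (E b c \<and> c \<noteq> a \<and> nbw E (b # a # xs))"

text \<open>The list contains both endpoints, so closed walks with fewer than \<open>g\<close> edges
  are excluded. Backtracking at the base point is allowed, which lets segments of a longer walk be
  tested directly.\<close>

definition nbgirth :: "('a \<Rightarrow> 'a \<Rightarrow> bool) \<Rightarrow> nat \<Rightarrow> bool" where
  "nbgirth E g \<longleftrightarrow> (\<forall>xs. nbw E xs \<and> 2 \<le> length xs \<and> length xs \<le> g \<longrightarrow> hd xs \<noteq> last xs)"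

definition near :: "('a \<Rightarrow> 'a \<Rightarrow> bool) \<Rightarrow> nat \<Rightarrow> ('a \<times> 'a) set" where
  "near E k = (Id \<union> {(a, b). E a b}) ^^ k"

definition adj :: "('a \<times> 'a) set \<Rightarrow> 'a \<Rightarrow> 'a \<Rightarrow> bool" where
  "adj C u v \<longleftrightarrow> (u, v) \<in> C \<or> (v, u) \<in> C"

lemma near_0 [simp]: "near E 0 = Id"
  by (simp add: near_def)

lemma near_trans: "(a, b) \<in> near E k \<Longrightarrow> (b, c) \<in> near E l \<Longrightarrow> (a, c) \<in> near E (k + l)"
  unfolding near_def by (auto simp: relpow_add)

lemma near_Suc_I: "(a, b) \<in> near E k \<Longrightarrow> E b c \<Longrightarrow> (a, c) \<in> near E (Suc k)"
  unfolding near_def by auto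

lemma near_mono:
  assumes "(a, b) \<in> near E k" "k \<le> l"
  shows "(a, b) \<in> near E l"
  using assms(2,1) by (induction rule: dec_induct) (auto simp: near_def)

lemma near_sym:
  assumes "\<And>a b. E a b \<Longrightarrow> E b a" "(a, b) \<in> near E k"
  shows "(b, a) \<in> near E k"
  using assms(2)
proof (induction k arbitrary: b)
  case (Suc k)
  then obtain z where z: "(a, z) \<in> near E k" "z = b \<or> E z b"
    by (auto simp: near_def)
  have "(b, z) \<in> near E 1"
    using z(2) assms(1) by (auto simp: near_def)
  from near_trans[OF this Suc.IH[OF z(1)]] show ?case by simp
qed simp

lemma card_near_le:
  assumes "\<And>v. finite {u. E v u} \<and> card {u. E v u} \<le> d"
  shows "finite {y. (x, y) \<in> near E k} \<and> card {y. (x, y) \<in> near E k} \<le> Suc d ^ k"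
proof (induction k)
  case (Suc k)
  define A where "A = {y. (x, y) \<in> near E k}"
  have eq: "{y. (x, y) \<in> near E (Suc k)} = (\<Union>z\<in>A. insert z {u. E z u})"
    by (auto simp: near_def A_def)
  have A: "finite A" "card A \<le> Suc d ^ k" using Suc by (auto simp: A_def)
  have "card (\<Union>z\<in>A. insert z {u. E z u}) \<le> (\<Sum>z\<in>A. card (insert z {u. E z u}))"
    by (rule card_UN_le) (rule A)
  also have "\<dots> \<le> (\<Sum>z\<in>A. Suc d)"
  proof (intro sum_mono)
    fix z
    show "card (insert z {u. E z u}) \<le> Suc d"
      using assms[of z] by (intro order_trans[OF card_insert_le_m1[of "Suc d"]]) auto
  qed
  also have "\<dots> \<le> Suc d ^ k * Suc d"
    using A by (simp only: sum_constant of_nat_id mult_right_mono zero_le)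
  finally show ?case
    unfolding eq using A assms by (auto simp: mult_ac)
qed simp

lemma nbw_near: "nbw E xs \<Longrightarrow> (last xs, hd xs) \<in> near E (length xs - 1)"
proof (induction E xs rule: nbw.induct)
  case (3 E b a)
  thus ?case using near_Suc_I[of a a E 0 b] by simp
next
  case (4 E c b a xs)
  thus ?case using near_Suc_I[of "last (b # a # xs)" b E "length (b # a # xs) - 1" c] by simp
qed auto

lemma nbw_Cons:
  assumes "nbw E xs" "E (hd xs) c" "length xs \<ge> 2 \<Longrightarrow> c \<noteq> xs ! 1"
  shows "nbw E (c # xs)"
  using assms by (cases "(E, xs)" rule: nbw.cases) auto

lemma adj_insert: "adj (insert (x, y) C) u v \<longleftrightarrow> adj C u v \<or> (u, v) = (x, y) \<or> (u, v) = (y, x)"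
  by (auto simp: adj_def)

lemma nbw_nonempty: "nbw E xs \<Longrightarrow> xs \<noteq> []"
  by auto

text \<open>A closed walk that uses the new edge once would join its ends by at most
  \<open>g\<close> old steps. A second use already forces such a connection, a backtrack, or a short
  closed walk in the old graph.\<close>

lemma nbgirth_insert:
  fixes C :: "('a \<times> 'a) set"
  assumes g: "nbgirth (adj C) g" and far: "(x, y) \<notin> near (adj C) g"
  shows "nbgirth (adj (insert (x, y) C)) g"
proof -
  define E where "E = adj C"
  have Esym: "E b a" if "E a b" for a b using that by (auto simp: E_def adj_def)
  have far2: False if "(p, q) = (x, y) \<or> (p, q) = (y, x)" "(p, q) \<in> near E k \<or> (q, p) \<in> near E k" "k \<le> g"
    for p q k
  proof -
    have "(x, y) \<in> near E k"
      using that(1,2) near_sym[of E, OF Esym] by blast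
    from near_mono[OF this that(3)] far show False by (simp add: E_def)
  qed
  \<comment> \<open>Once the new edge has been used from \<open>p\<close> to \<open>q\<close>,
    \<open>ys\<close> is the old walk since then and \<open>l\<close> the length of the walk before.
    The last clause recovers the previous vertex, on which the backtracking test depends.\<close>
  have inv: "nbw E xs \<or> (\<exists>ys p q l. ((p, q) = (x, y) \<or> (p, q) = (y, x)) \<and> nbw E ys \<and> hd ys = hd xs \<and>
      last ys = q \<and> (last xs, p) \<in> near E l \<and> l + length ys < length xs \<and>
      (if length ys = 1 then xs ! 1 = p else xs ! 1 = ys ! 1))"
    if "nbw (adj (insert (x, y) C)) xs" "length xs \<le> g" for xs
    using that
  proof (induction xs)
    case (Cons c xs)
    show ?case
    proof (cases xs)
      case Nil
      thus ?thesis by simp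
    next
      case (Cons b zs)
      have nb: "nbw (adj (insert (x, y) C)) xs" and bc: "adj (insert (x, y) C) b c"
        and bk: "length xs \<ge> 2 \<Longrightarrow> c \<noteq> xs ! 1"
        using Cons.prems(1) Cons by (cases zs; auto)+
      have hd: "hd xs = b" using Cons by simp
      from Cons.IH[OF nb] Cons.prems(2)
      consider (pure) "nbw E xs" | (used) ys p q l where "(p, q) = (x, y) \<or> (p, q) = (y, x)"
        "nbw E ys" "hd ys = b" "last ys = q" "(last xs, p) \<in> near E l" "l + length ys < length xs"
        "if length ys = 1 then xs ! 1 = p else xs ! 1 = ys ! 1"
        using hd by auto
      thus ?thesis
      proof cases
        case pure
        show ?thesis
        proof (cases "E b c")
          case True
          thus ?thesis using nbw_Cons[OF pure, of c] bk hd by auto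
        next
          case False
          hence new: "(b, c) = (x, y) \<or> (b, c) = (y, x)"
            using bc by (auto simp: adj_insert E_def)
          have "(last xs, b) \<in> near E (length xs - 1)"
            using nbw_near[OF pure] hd by simp
          thus ?thesis
            using new Cons by (intro disjI2 exI[of _ "[c]"] exI[of _ b] exI[of _ c] exI[of _ "length xs - 1"]) auto
        qed
      next
        case used
        have ys: "ys \<noteq> []" using used by auto
        have len: "length xs \<ge> 2" using used(6) ys by (cases ys) auto
        have lys: "length ys \<le> g" using used(6) Cons.prems(2) by simp
        show ?thesis
        proof (cases "E b c")
          case True
          have "nbw E (c # ys)"
          proof (rule nbw_Cons)
            show "c \<noteq> ys ! 1" if "length ys \<ge> 2"
              using that used(7) bk[OF len] by (auto split: if_splits)
          qed (use used True in auto)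
          moreover have "ys ! 0 = b" using used(3) ys by (simp add: hd_conv_nth)
          ultimately show ?thesis
            using used ys Cons
            by (intro disjI2 exI[of _ "c # ys"] exI[of _ p] exI[of _ q] exI[of _ l]) auto
        next
          case False
          hence new: "(b, c) = (x, y) \<or> (b, c) = (y, x)"
            using bc by (auto simp: adj_insert E_def)
          \<comment> \<open>A second use from \<open>q\<close> backtracks at once or closes
            \<open>ys\<close> up; from \<open>p\<close>, it means that \<open>ys\<close> joins the
            ends of the new edge.\<close>
          have False
          proof (cases "b = q")
            case True
            show False
            proof (cases "length ys = 1")
              case True
              hence "xs ! 1 = p" using used(7) by simp
              moreover have "c = p" using new used(1) \<open>b = q\<close> by auto
              ultimately show False using bk[OF len] by simp
            next
              case False
              hence "length ys \<ge> 2" using ys by (cases ys) (auto simp: Suc_le_eq)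
              thus False
                using g used(2,3,4) lys \<open>b = q\<close> unfolding nbgirth_def E_def by metis
            qed
          next
            case False
            hence "b = p" using new used(1) by auto
            have "(q, p) \<in> near E (length ys - 1)"
              using nbw_near[OF used(2)] used(3,4) \<open>b = p\<close> by simp
            thus False using far2[OF used(1)] lys by (metis diff_le_self order_trans)
          qed
          thus ?thesis ..
        qed
      qed
    qed
  qed simp
  show ?thesis
    unfolding nbgirth_def
  proof (intro allI impI notI)
    fix xs assume xs: "nbw (adj (insert (x, y) C)) xs \<and> 2 \<le> length xs \<and> length xs \<le> g"
      and closed: "hd xs = last xs"
    from xs inv[of xs] consider "nbw E xs" | (used) ys p q l where "(p, q) = (x, y) \<or> (p, q) = (y, x)"
        "nbw E ys" "hd ys = hd xs" "last ys = q" "(last xs, p) \<in> near E l" "l + length ys < length xs"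
      by blast
    thus False
    proof cases
      case 1
      thus False using g xs closed unfolding nbgirth_def E_def by metis
    next
      case used
      have "(q, hd xs) \<in> near E (length ys - 1)"
        using nbw_near[OF used(2)] used(3,4) by simp
      from near_trans[OF this] used(5) closed have "(q, p) \<in> near E (length ys - 1 + l)" by simp
      thus False
        by (intro far2[OF used(1), of "length ys - 1 + l"]) (use used xs in auto)
    qed
  qed
qed

section \<open>Completion to a regular graph\<close>

text \<open>
  The edge colours used along a non-backtracking walk form a word. If a colour were repeated
  immediately, the walk between its two uses would be a closed non-backtracking walk in \<open>H\<close>, so the
  word is reduced; a closed walk has the empty word and thus lies in one copy of \<open>H\<close>.
\<close>

lemma nbgirth_lift:
  fixes H :: "'a \<Rightarrow> 'a \<Rightarrow> bool" and E :: "'a \<times> 's \<Rightarrow> 'a \<times> 's \<Rightarrow> bool"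
    and \<tau> :: "'a \<times> nat \<Rightarrow> 's \<Rightarrow> 's"
  assumes H: "nbgirth H g"
    and E: "\<And>x y. E x y \<Longrightarrow> (snd x = snd y \<and> H (fst x) (fst y)) \<or>
      (fst x = fst y \<and> (\<exists>c\<in>Col. fst c = fst x \<and> snd y = \<tau> c (snd x)))"
    and E_P: "\<And>x y. E x y \<Longrightarrow> snd x \<in> P"
    and invol: "\<And>c s. \<tau> c (\<tau> c s) = s"
    and free: "\<And>w s. w \<noteq> [] \<Longrightarrow> successively (\<noteq>) w \<Longrightarrow> set w \<subseteq> Col \<Longrightarrow> length w \<le> g \<Longrightarrow>
      s \<in> P \<Longrightarrow> foldr \<tau> w s \<noteq> s"
  shows "nbgirth E g"
proof -
  \<comment> \<open>\<open>w\<close> is the word of colours used, latest first, and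
    \<open>ys\<close> the walk in \<open>H\<close> since the latest one. The clauses on
    \<open>xs ! 1\<close> recover the previous vertex.\<close>
  define Inv where "Inv xs w ys \<longleftrightarrow>
      successively (\<noteq>) w \<and> set w \<subseteq> Col \<and> length w + length ys \<le> length xs \<and>
      foldr \<tau> w (snd (last xs)) = snd (hd xs) \<and> nbw H ys \<and> hd ys = fst (hd xs) \<and>
      (w = [] \<longrightarrow> last ys = fst (last xs) \<and> length ys = length xs) \<and>
      (\<forall>c w'. w = c # w' \<longrightarrow> last ys = fst c \<and>
        (length ys = 1 \<longrightarrow> xs ! 1 = (fst c, foldr \<tau> w' (snd (last xs))))) \<and>
      (length ys \<ge> 2 \<longrightarrow> xs ! 1 = (ys ! 1, snd (hd xs)))"
    for xs :: "('a \<times> 's) list" and w ys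
  have inv: "\<exists>w ys. Inv xs w ys" if "nbw E xs" "length xs \<le> g" for xs
    using that
  proof (induction xs)
    case (Cons z xs)
    show ?case
    proof (cases xs)
      case Nil
      thus ?thesis by (intro exI[of _ "[]"] exI[of _ "[fst z]"]) (auto simp: Inv_def)
    next
      case (Cons b zs)
      have nb: "nbw E xs" and bz: "E b z" and bk: "length xs \<ge> 2 \<Longrightarrow> z \<noteq> xs ! 1"
        using Cons.prems(1) Cons by (cases zs; auto)+
      define s0 where "s0 = snd (last xs)"
      have hd: "hd xs = b" and last: "last (z # xs) = last xs" and xs: "xs \<noteq> []"
        using Cons by auto
      from Cons.IH[OF nb] Cons.prems(2) obtain w ys where I: "Inv xs w ys" by auto
      have w: "successively (\<noteq>) w" "set w \<subseteq> Col"
        "length w + length ys \<le> length xs" "foldr \<tau> w s0 = snd b"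
        and ys: "nbw H ys" "hd ys = fst b"
        using I hd unfolding Inv_def s0_def by blast+
      have w0: "w = [] \<Longrightarrow> last ys = fst (last xs) \<and> length ys = length xs"
        using I unfolding Inv_def by blast
      have w1: "w = c # w' \<Longrightarrow> last ys = fst c \<and>
          (length ys = 1 \<longrightarrow> xs ! 1 = (fst c, foldr \<tau> w' s0))" for c w'
        using I unfolding Inv_def s0_def by blast
      have ys2: "length ys \<ge> 2 \<Longrightarrow> xs ! 1 = (ys ! 1, snd b)"
        using I hd unfolding Inv_def by blast
      have ys0: "ys \<noteq> []" using ys by auto
      hence ysl: "length ys \<ge> 1" by (cases ys) auto
      from E[OF bz] consider (inner) "snd b = snd z" "H (fst b) (fst z)"
        | (outer) c where "fst b = fst z" "c \<in> Col" "fst c = fst b" "snd z = \<tau> c (snd b)"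
        by blast
      thus ?thesis
      proof cases
        case inner
        have "nbw H (fst z # ys)"
        proof (rule nbw_Cons)
          show "fst z \<noteq> ys ! 1" if "length ys \<ge> 2"
          proof
            assume "fst z = ys ! 1"
            hence "z = xs ! 1" using ys2[OF that] inner by (simp add: prod_eq_iff)
            moreover have "length xs \<ge> 2" using w(3) that by simp
            ultimately show False using bk by simp
          qed
        qed (use ys inner in auto)
        moreover have "ys ! 0 = fst b" using ys ys0 by (simp add: hd_conv_nth)
        moreover have "xs ! 0 = b" using hd xs by (simp add: hd_conv_nth)
        ultimately show ?thesis
          using w w0 w1 inner ys0 xs unfolding Inv_def last s0_def[symmetric]
          by (intro exI[of _ w] exI[of _ "fst z # ys"]) (auto simp: prod_eq_iff)
      next
        case outer
        have red: "c' \<noteq> c" if "w = c' # w'" for c' w'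
        proof
          assume [simp]: "c' = c"
          have len: "length xs \<ge> 2" using w(3) that ysl by simp
          have l: "last ys = hd ys" using w1[OF that] outer ys by simp
          \<comment> \<open>With no step of \<open>H\<close> in between, the involution
            \<open>\<tau> c\<close> leads straight back, a backtrack; otherwise \<open>ys\<close> is
            a closed walk in \<open>H\<close>.\<close>
          show False
          proof (cases "length ys = 1")
            case True
            hence "xs ! 1 = (fst c, foldr \<tau> w' s0)" using w1[OF that] by simp
            moreover have "snd z = foldr \<tau> w' s0"
              using w(4) that outer(4) invol by (metis \<open>c' = c\<close> foldr.simps(2) o_apply)
            ultimately have "z = xs ! 1" using outer by (simp add: prod_eq_iff)
            thus False using bk len by simp
          next
            case False
            hence "2 \<le> length ys" using ysl by simp
            moreover have "length ys \<le> g" using w(3) Cons.prems(2) by simp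
            ultimately show False using H ys l unfolding nbgirth_def by metis
          qed
        qed
        have "successively (\<noteq>) (c # w)"
          using w(1) red by (cases w) auto
        moreover have "xs ! 0 = b" using hd xs by (simp add: hd_conv_nth)
        ultimately show ?thesis
          using w outer ysl unfolding Inv_def last s0_def[symmetric]
          by (intro exI[of _ "c # w"] exI[of _ "[fst z]"]) (auto simp: prod_eq_iff)
      qed
    qed
  qed simp
  show ?thesis
    unfolding nbgirth_def
  proof (intro allI impI notI)
    fix xs assume xs: "nbw E xs \<and> 2 \<le> length xs \<and> length xs \<le> g" and closed: "hd xs = last xs"
    obtain w ys where I: "Inv xs w ys"
      using inv[of xs] xs by blast
    have w: "successively (\<noteq>) w" "set w \<subseteq> Col" "length w + length ys \<le> length xs"
       "foldr \<tau> w (snd (last xs)) = snd (hd xs)" "nbw H ys" "hd ys = fst (hd xs)"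
       "w = [] \<longrightarrow> last ys = fst (last xs) \<and> length ys = length xs"
      using I unfolding Inv_def by blast+
    have "snd (last xs) \<in> P"
    proof -
      have "snd (last xs) \<in> P" if "nbw E xs" "2 \<le> length xs" for xs
        using that
      proof (induction xs)
        case (Cons z xs)
        thus ?case by (cases "(E, z # xs)" rule: nbw.cases) (auto dest: E_P)
      qed simp
      thus ?thesis using xs by blast
    qed
    moreover have "length w \<le> g" using w(3) xs by simp
    ultimately have "w = []"
      using free[of w "snd (last xs)"] w(1,2,4) closed by auto
    with w closed have "hd ys = last ys" "length ys = length xs" by auto
    thus False using H w(5) xs unfolding nbgirth_def by metis
  qed
qed

text \<open>
  Each \<open>c\<close> acts on the reduced words of length at most \<open>g\<close> over the involutions \<open>Col\<close> by left
  multiplication. A nonempty reduced word \<open>w\<close> of length at most \<open>g\<close> acts nontrivially, as it sends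
  the empty word to \<open>w\<close>.
\<close>

definition words :: "'c set \<Rightarrow> nat \<Rightarrow> 'c list set" where
  "words Col g = {w. set w \<subseteq> Col \<and> length w \<le> g \<and> successively (\<noteq>) w}"

definition toggle :: "'c set \<Rightarrow> nat \<Rightarrow> 'c \<Rightarrow> 'c list \<Rightarrow> 'c list" where
  "toggle Col g c w = (if w \<notin> words Col g \<or> c \<notin> Col then w
     else if w \<noteq> [] \<and> hd w = c then tl w
     else if length w < g then c # w else w)"

lemma finite_words: "finite Col \<Longrightarrow> finite (words Col g)"
  by (rule finite_subset[OF _ finite_lists_length_le[of Col g]]) (auto simp: words_def)

lemma toggle_invol: "toggle Col g c (toggle Col g c w) = w"
proof (cases w)
  case Nil
  thus ?thesis by (auto simp: toggle_def words_def)
next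
  case (Cons a v)
  thus ?thesis
    by (cases v) (auto simp: toggle_def words_def)
qed

lemma toggle_permutes: "toggle Col g c permutes words Col g"
proof (rule bij_imp_permutes)
  have mem: "toggle Col g c w \<in> words Col g" if "w \<in> words Col g" for w
    using that by (cases w; cases "tl w") (auto simp: toggle_def words_def)
  show "bij_betw (toggle Col g c) (words Col g) (words Col g)"
    by (rule bij_betwI[of _ _ _ "toggle Col g c"]) (auto simp: toggle_invol mem)
qed (auto simp: toggle_def)

text \<open>Suffixes of a reduced word are reduced and shorter, so each letter of \<open>w\<close>,
  read from the right, is prepended and never cancelled or dropped for lack of room.\<close>

lemma foldr_toggle_Nil:
  "w \<in> words Col g \<Longrightarrow> foldr (toggle Col g) w [] = w"
proof (induction w)
  case (Cons c w)
  hence "w \<in> words Col g" by (cases w) (auto simp: words_def)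
  thus ?case using Cons by (cases w) (auto simp: toggle_def words_def)
qed simp

text \<open>A cycle traversed once does not backtrack, as its three or more vertices are distinct.
  As a closed walk it has \<open>length cs + 1\<close> entries.\<close>

lemma nbgirth_imp_girth_at_least:
  assumes "nbgirth E g"
  shows "girth_at_least V E g"
  unfolding girth_at_least_def
proof (intro allI impI)
  fix cs assume "is_cycle V E cs"
  hence cs: "length cs \<ge> 3" "distinct cs" "\<And>i. i < length cs \<Longrightarrow> E (cs ! i) (cs ! ((i + 1) mod length cs))"
    by (auto simp: is_cycle_def)
  have walk: "nbw E (rev (take (Suc i) cs))" if "i < length cs" for i
    using that
  proof (induction i)
    case 0
    thus ?case by (cases cs) auto
  next
    case (Suc i)
    have "nbw E (cs ! Suc i # rev (take (Suc i) cs))"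
    proof (rule nbw_Cons)
      show "nbw E (rev (take (Suc i) cs))" using Suc by simp
      have h: "hd (rev (take (Suc i) cs)) = cs ! i"
        using Suc.prems by (simp add: take_Suc_conv_app_nth)
      show "E (hd (rev (take (Suc i) cs))) (cs ! Suc i)"
        unfolding h using cs(3)[of i] Suc.prems by simp
      show "cs ! Suc i \<noteq> rev (take (Suc i) cs) ! 1" if "2 \<le> length (rev (take (Suc i) cs))"
        using that Suc.prems cs(2) by (simp add: rev_nth nth_eq_iff_index_eq)
    qed
    thus ?case using Suc.prems by (simp add: take_Suc_conv_app_nth)
  qed
  have ne: "cs \<noteq> []" using cs(1) by auto
  have "nbw E (hd cs # rev cs)"
  proof (rule nbw_Cons)
    show "nbw E (rev cs)" using walk[of "length cs - 1"] cs(1) by simp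
    show "E (hd (rev cs)) (hd cs)"
      using cs(3)[of "length cs - 1"] ne by (simp add: hd_rev last_conv_nth hd_conv_nth)
    show "hd cs \<noteq> rev cs ! 1"
      using cs(1,2) ne by (simp add: rev_nth hd_conv_nth nth_eq_iff_index_eq)
  qed
  moreover have "hd (hd cs # rev cs) = last (hd cs # rev cs)" "2 \<le> length (hd cs # rev cs)"
    using ne cs(1) by (auto simp: last_rev)
  ultimately have "\<not> length (hd cs # rev cs) \<le> g"
    using assms unfolding nbgirth_def by blast
  thus "g \<le> length cs" by simp
qed

text \<open>Copies of \<open>H\<close> are joined between twins of one vertex, with one edge for
  each missing degree. An independent set meets each copy in at most \<open>a\<close> vertices, so
  the ratio stays at most \<open>a / card V\<close>.\<close>

theorem regular_completion:
  fixes H :: "'a \<Rightarrow> 'a \<Rightarrow> bool" and V :: "'a set"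
  assumes V: "finite V" "V \<noteq> {}"
    and HV: "\<And>u v. H u v \<Longrightarrow> u \<in> V \<and> v \<in> V"
    and sym: "\<And>u v. H u v \<Longrightarrow> H v u" and irr: "\<And>u. \<not> H u u"
    and deg: "\<And>v. v \<in> V \<Longrightarrow> card {u \<in> V. H v u} \<le> d"
    and girth: "nbgirth H g" and g: "g \<ge> 1"
    and ind: "\<And>S. S \<subseteq> V \<Longrightarrow> (\<And>u v. u \<in> S \<Longrightarrow> v \<in> S \<Longrightarrow> \<not> H u v) \<Longrightarrow> card S \<le> a"
  shows "\<exists>V' E'. simple_graph V' E' \<and> regular d V' E' \<and> girth_at_least V' E' g \<and>
    independence_ratio V' E' \<le> real a / real (card V)"
proof -
  define slots where "slots v = d - card {u \<in> V. H v u}" for v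
  define Col where "Col = (SIGMA v:V. {..<slots v})"
  \<comment> \<open>Permutations of the words, not the words, index the copies: composition with the
    toggle of a colour in \<open>Col\<close> moves every permutation, whereas the toggle itself
    fixes words of full length that start with another colour.\<close>
  define P where "P = {\<sigma>. \<sigma> permutes words Col g}"
  define \<tau> where "\<tau> c \<sigma> = toggle Col g c \<circ> \<sigma>" for c and \<sigma> :: "('a \<times> nat) list \<Rightarrow> ('a \<times> nat) list"
  define E where "E x y \<longleftrightarrow> x \<in> V \<times> P \<and> y \<in> V \<times> P \<and> ((snd x = snd y \<and> H (fst x) (fst y)) \<or>
      (fst x = fst y \<and> (\<exists>c\<in>Col. fst c = fst x \<and> snd y = \<tau> c (snd x))))" for x y
  have fin_Col: "finite Col" unfolding Col_def using V by auto
  have P: "finite P" "id \<in> P"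
    unfolding P_def by (auto intro: finite_permutations finite_words fin_Col permutes_id)
  have \<tau>P: "\<tau> c \<sigma> \<in> P" if "\<sigma> \<in> P" for c \<sigma>
    using that by (auto simp: P_def \<tau>_def intro: permutes_compose toggle_permutes)
  have \<tau>\<tau>: "\<tau> c (\<tau> c \<sigma>) = \<sigma>" for c \<sigma>
    by (auto simp: \<tau>_def toggle_invol fun_eq_iff)
  have fold_\<tau>: "foldr \<tau> w \<sigma> x = foldr (toggle Col g) w (\<sigma> x)" for w \<sigma> x
    by (induction w) (auto simp: \<tau>_def)
  have Nil_word: "[] \<in> words Col g" by (auto simp: words_def)
  have free: "foldr \<tau> w \<sigma> \<noteq> \<sigma>"
    if "w \<noteq> []" "successively (\<noteq>) w" "set w \<subseteq> Col" "length w \<le> g" "\<sigma> \<in> P" for w \<sigma>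
  proof
    note \<sigma> = that(5)
    assume eq: "foldr \<tau> w \<sigma> = \<sigma>"
    have w: "w \<in> words Col g" using that by (simp add: words_def)
    \<comment> \<open>At the preimage of the empty word, the toggles of \<open>w\<close> produce
      \<open>w\<close> itself.\<close>
    obtain x where "\<sigma> x = []" using \<sigma> permutes_surj unfolding P_def by (metis mem_Collect_eq surjD)
    with eq fold_\<tau>[of w \<sigma> x] foldr_toggle_Nil[OF w] that(1) show False by simp
  qed
  have "nbgirth E g"
    by (rule nbgirth_lift[OF girth, where Col = Col and P = P and \<tau> = \<tau>])
       (use free in \<open>auto simp: E_def \<tau>\<tau>\<close>)
  have E_sym: "E y x" if "E x y" for x y
    using that sym \<tau>\<tau> unfolding E_def by metis
  have \<tau>_ne: "\<tau> c \<sigma> \<noteq> \<sigma>" if "c \<in> Col" "\<sigma> \<in> P" for c \<sigma>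
    using free[of "[c]" \<sigma>] that g by simp
  have E_irr: "\<not> E x x" for x
    using irr \<tau>_ne unfolding E_def by (metis mem_Times_iff)
  \<comment> \<open>No parallel edges arise: at the preimage of the empty word, two colours yield
    the words \<open>[c]\<close> and \<open>[c']\<close>, for which \<open>g \<ge> 1\<close> leaves
    room.\<close>
  have \<tau>_inj: "c = c'" if "\<tau> c \<sigma> = \<tau> c' \<sigma>" "c \<in> Col" "c' \<in> Col" "\<sigma> \<in> P" for c c' \<sigma>
  proof -
    note \<sigma> = that(4)
    obtain x where x: "\<sigma> x = []"
      using \<sigma> permutes_surj unfolding P_def by (metis mem_Collect_eq surjD)
    from that(1) have "toggle Col g c (\<sigma> x) = toggle Col g c' (\<sigma> x)"
      unfolding \<tau>_def by (metis o_apply)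
    thus ?thesis using that x g Nil_word by (auto simp: toggle_def)
  qed
  have E_deg: "card {y \<in> V \<times> P. E x y} = d" if x: "x \<in> V \<times> P" for x
  proof -
    obtain v \<sigma> where [simp]: "x = (v, \<sigma>)" and v: "v \<in> V" "\<sigma> \<in> P" using x by auto
    define A where "A = {u \<in> V. H v u}"
    define B where "B = (\<lambda>i. (v, \<tau> (v, i) \<sigma>)) ` {..<slots v}"
    have "{y \<in> V \<times> P. E x y} = (\<lambda>u. (u, \<sigma>)) ` A \<union> B"
      using v HV \<tau>P by (auto simp: E_def A_def B_def Col_def)
    moreover have "(\<lambda>u. (u, \<sigma>)) ` A \<inter> B = {}"
      using \<tau>_ne v by (auto simp: B_def Col_def A_def irr)
    moreover have "card B = slots v"
      unfolding B_def
    proof (subst card_image)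
      show "inj_on (\<lambda>i. (v, \<tau> (v, i) \<sigma>)) {..<slots v}"
        using \<tau>_inj v by (fastforce intro!: inj_onI simp: Col_def)
    qed simp
    moreover have "card ((\<lambda>u. (u, \<sigma>)) ` A) = card A"
      by (rule card_image) (auto intro: inj_onI)
    moreover have "finite A" "finite B" using V by (auto simp: A_def B_def)
    ultimately have "card {y \<in> V \<times> P. E x y} = card A + slots v"
      by (simp add: card_Un_disjoint)
    thus ?thesis using deg[OF v(1)] by (simp add: slots_def A_def)
  qed
  have fin: "finite (V \<times> P)" using V P by auto
  then obtain f :: "'a \<times> (('a \<times> nat) list \<Rightarrow> ('a \<times> nat) list) \<Rightarrow> nat" where f: "inj_on f (V \<times> P)"
    using finite_imp_inj_to_nat_seg by metis
  define V' where "V' = f ` (V \<times> P)"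
  define h where "h = the_inv_into (V \<times> P) f"
  define E' where "E' x y \<longleftrightarrow> x \<in> V' \<and> y \<in> V' \<and> E (h x) (h y)" for x y
  have hf: "h (f x) = x" if "x \<in> V \<times> P" for x
    unfolding h_def by (rule the_inv_into_f_f[OF f that])
  have hV: "h x \<in> V \<times> P" "f (h x) = x" if "x \<in> V'" for x
    using that hf by (auto simp: V'_def)
  have h_inj: "inj_on h V'" using hV(2) by (metis inj_onI)
  have "simple_graph V' E'"
    unfolding simple_graph_def using fin V P E_sym E_irr by (auto simp: V'_def E'_def)
  moreover have "regular d V' E'"
    unfolding regular_def
  proof
    fix v assume v: "v \<in> V'"
    have "h ` {u \<in> V'. E' v u} = {y \<in> V \<times> P. E (h v) y}"
    proof (intro set_eqI iffI)
      fix y assume y: "y \<in> {y \<in> V \<times> P. E (h v) y}"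
      hence "f y \<in> V'" "h (f y) = y" using hf by (auto simp: V'_def)
      thus "y \<in> h ` {u \<in> V'. E' v u}" using y v by (intro image_eqI[of _ _ "f y"]) (auto simp: E'_def)
    next
      fix y assume "y \<in> h ` {u \<in> V'. E' v u}"
      then obtain x where "x \<in> V'" "E' v x" "y = h x" by blast
      thus "y \<in> {y \<in> V \<times> P. E (h v) y}" using hV(1)[of x] by (simp add: E'_def)
    qed
    moreover have "card (h ` {u \<in> V'. E' v u}) = card {u \<in> V'. E' v u}"
      by (rule card_image) (auto intro: inj_on_subset[OF h_inj])
    ultimately show "card {u \<in> V'. E' v u} = d" using E_deg hV(1)[OF v] by simp
  qed
  moreover have "girth_at_least V' E' g"
  proof (rule nbgirth_imp_girth_at_least)
    have "nbw E (map h xs)" if "nbw E' xs" for xs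
      using that
    proof (induction xs)
      case (Cons z xs)
      show ?case
      proof (cases xs)
        case Nil
        thus ?thesis by simp
      next
        case (Cons b ys)
        have nb: "nbw E' xs" and bz: "E' b z" and bk: "length xs \<ge> 2 \<Longrightarrow> z \<noteq> xs ! 1"
          using Cons.prems Cons by (cases ys; auto)+
        have neq: "h z \<noteq> h (xs ! 1)" if "length xs \<ge> 2"
        proof -
          have "xs ! 1 \<in> V'" "z \<in> V'"
            using nb bz that Cons by (cases ys; cases "tl ys"; auto simp: E'_def)+
          thus ?thesis using bk[OF that] h_inj by (auto simp: inj_on_eq_iff)
        qed
        have "nbw E (h z # map h xs)"
        proof (intro nbw_Cons)
          show "nbw E (map h xs)" by (rule Cons.IH[OF nb])
          show "E (hd (map h xs)) (h z)" using bz Cons by (simp add: E'_def)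
          show "h z \<noteq> map h xs ! 1" if "2 \<le> length (map h xs)"
            using that neq by (subst nth_map) simp_all
        qed
        thus ?thesis by simp
      qed
    qed simp
    thus "nbgirth E' g"
      using \<open>nbgirth E g\<close> unfolding nbgirth_def
      by (metis hd_map last_map length_map nbw_nonempty)
  qed
  moreover have "independence_ratio V' E' \<le> real a / real (card V)"
  proof -
    have cV': "card V' = card V * card P"
      unfolding V'_def by (simp add: card_image[OF f] card_cartesian_product)
    have pos: "card V > 0" "card P > 0" using V P by (auto simp: card_gt_0_iff)
    have "card S \<le> a * card P" if S: "independent_set V' E' S" for S
    proof -
      have SV: "S \<subseteq> V'" and SE: "\<And>x y. x \<in> S \<Longrightarrow> y \<in> S \<Longrightarrow> \<not> E' x y"
        using S by (auto simp: independent_set_def)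
      define T where "T \<sigma> = {u \<in> V. (u, \<sigma>) \<in> h ` S}" for \<sigma>
      have T: "card (T \<sigma>) \<le> a" if "\<sigma> \<in> P" for \<sigma>
      proof (rule ind)
        fix u v assume "u \<in> T \<sigma>" "v \<in> T \<sigma>"
        then obtain x y where "x \<in> S" "y \<in> S" "h x = (u, \<sigma>)" "h y = (v, \<sigma>)" "u \<in> V" "v \<in> V"
          by (force simp: T_def)
        thus "\<not> H u v" using SE[of x y] SV \<open>\<sigma> \<in> P\<close> by (auto simp: E'_def E_def)
      qed (auto simp: T_def)
      have "card S = card (h ` S)"
        by (rule card_image[symmetric]) (rule inj_on_subset[OF h_inj SV])
      also have "h ` S = (\<Union>\<sigma>\<in>P. (\<lambda>u. (u, \<sigma>)) ` T \<sigma>)"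
        using SV hV(1) by (force simp: T_def)
      also have "card \<dots> \<le> (\<Sum>\<sigma>\<in>P. card ((\<lambda>u. (u, \<sigma>)) ` T \<sigma>))"
        by (rule card_UN_le) (rule P)
      also have "\<dots> \<le> (\<Sum>\<sigma>\<in>P. a)"
        using V by (intro sum_mono order_trans[OF card_image_le T]) (auto simp: T_def)
      finally show ?thesis by (simp add: mult.commute)
    qed
    moreover have "finite {S. independent_set V' E' S}"
      by (rule finite_subset[of _ "Pow V'"]) (use fin in \<open>auto simp: independent_set_def V'_def\<close>)
    moreover have "{S. independent_set V' E' S} \<noteq> {}"
      by (auto simp: independent_set_def intro: exI[of _ "{}"])
    ultimately have "independence_number V' E' \<le> a * card P"
      unfolding independence_number_def by (subst Max_le_iff) auto
    hence "real (independence_number V' E') \<le> real a * real (card P)"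
      by (metis of_nat_le_iff of_nat_mult)
    hence "independence_ratio V' E' \<le> real a * real (card P) / real (card V')"
      unfolding independence_ratio_def by (rule divide_right_mono) simp
    thus ?thesis using pos by (simp add: cV')
  qed
  ultimately show ?thesis by blast
qed

section \<open>Interpolation\<close>

text \<open>A pair \<open>(v, v)\<close> in the constraint set \<open>C\<close> is a warning at \<open>v\<close>: it excludes \<open>v\<close>.\<close>

definition indep_sets :: "nat \<Rightarrow> (nat \<times> nat) set \<Rightarrow> nat set set" where
  "indep_sets n C = {S. S \<subseteq> {..<n} \<and> (\<forall>(u, v)\<in>C. \<not> (u \<in> S \<and> v \<in> S))}"

definition alpha :: "nat \<Rightarrow> (nat \<times> nat) set \<Rightarrow> nat" where
  "alpha n C = Max (card ` indep_sets n C)"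

definition frozen :: "nat \<Rightarrow> (nat \<times> nat) set \<Rightarrow> nat set" where
  "frozen n C = {v. \<forall>S\<in>indep_sets n C. card S = alpha n C \<longrightarrow> v \<in> S}"

section \<open>Effect of a single constraint on the independence number\<close>

lemma finite_indep_sets: "finite (indep_sets n C)"
  by (rule finite_subset[of _ "Pow {..<n}"]) (auto simp: indep_sets_def)

lemma empty_in_indep_sets: "{} \<in> indep_sets n C"
  by (auto simp: indep_sets_def)

lemma card_le_alpha: "S \<in> indep_sets n C \<Longrightarrow> card S \<le> alpha n C"
  unfolding alpha_def by (rule Max_ge) (auto simp: finite_indep_sets)

lemma alpha_attained:
  obtains S where "S \<in> indep_sets n C" "card S = alpha n C"
proof -
  have "alpha n C \<in> card ` indep_sets n C"
    unfolding alpha_def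
    by (rule Max_in) (use finite_indep_sets[of n C] empty_in_indep_sets[of n C] in auto)
  thus ?thesis using that by auto
qed

lemma indep_sets_insert:
  "indep_sets n (insert (u, v) C) = {S \<in> indep_sets n C. \<not> (u \<in> S \<and> v \<in> S)}"
  by (auto simp: indep_sets_def)

lemma alpha_insert_le: "alpha n (insert e C) \<le> alpha n C"
  by (metis (mono_tags, lifting) alpha_attained card_le_alpha indep_sets_insert mem_Collect_eq
      surj_pair)

text \<open>Every maximum set contains both \<open>u\<close> and \<open>v\<close>, so none survives
  the new constraint.\<close>

lemma alpha_insert_frozen:
  assumes "u \<in> frozen n C" "v \<in> frozen n C"
  shows "alpha n (insert (u, v) C) < alpha n C"
proof -
  obtain S where S: "S \<in> indep_sets n (insert (u, v) C)" "card S = alpha n (insert (u, v) C)"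
    by (rule alpha_attained)
  hence "S \<in> indep_sets n C" "\<not> (u \<in> S \<and> v \<in> S)" by (auto simp: indep_sets_insert)
  with assms have "card S \<noteq> alpha n C" by (auto simp: frozen_def)
  with card_le_alpha[OF \<open>S \<in> indep_sets n C\<close>] S show ?thesis by simp
qed

lemma alpha_le_insert_loop: "alpha n C \<le> alpha n (insert (v, v) C) + 1"
proof -
  obtain S where S: "S \<in> indep_sets n C" "card S = alpha n C"
    by (rule alpha_attained)
  hence "S - {v} \<in> indep_sets n (insert (v, v) C)"
    by (auto simp: indep_sets_def)
  from card_le_alpha[OF this] have "card (S - {v}) \<le> alpha n (insert (v, v) C)" .
  moreover have "card S \<le> card (S - {v}) + 1"
    by (auto simp: card_Diff_singleton_if)
  ultimately show ?thesis using S by simp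
qed

lemma alpha_insert_loop_unfrozen:
  assumes "v \<notin> frozen n C"
  shows "alpha n (insert (v, v) C) = alpha n C"
proof -
  obtain S where S: "S \<in> indep_sets n C" "card S = alpha n C" "v \<notin> S"
    using assms by (auto simp: frozen_def)
  hence "S \<in> indep_sets n (insert (v, v) C)" by (auto simp: indep_sets_insert)
  from card_le_alpha[OF this] S alpha_insert_le[of n "(v, v)" C] show ?thesis by simp
qed

lemma sum_swap_distinct:
  fixes f :: "'a \<Rightarrow> 'a \<Rightarrow> real"
  assumes "finite R"
  shows "(\<Sum>x\<in>R. \<Sum>y\<in>R - {x}. f x y) = (\<Sum>y\<in>R. \<Sum>x\<in>R - {y}. f x y)"
proof -
  have "(\<Sum>x\<in>R. \<Sum>y\<in>R - {x}. f x y) = (\<Sum>x\<in>R. \<Sum>y | y \<in> R \<and> x \<noteq> y. f x y)"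
    by (intro sum.cong) auto
  also have "\<dots> = (\<Sum>y\<in>R. \<Sum>x | x \<in> R \<and> x \<noteq> y. f x y)"
    by (rule sum.swap_restrict) (use assms in auto)
  also have "\<dots> = (\<Sum>y\<in>R. \<Sum>x\<in>R - {y}. f x y)"
    by (intro sum.cong) auto
  finally show ?thesis .
qed

text \<open>This moves a warning drawn after an edge in front of that edge.\<close>

lemma sum_rotate_distinct:
  fixes f :: "'a \<Rightarrow> 'a \<Rightarrow> 'a \<Rightarrow> real"
  assumes "finite R"
  shows "(\<Sum>x\<in>R. \<Sum>y\<in>R - {x}. \<Sum>z\<in>R - {x, y}. f x y z) =
         (\<Sum>z\<in>R. \<Sum>x\<in>R - {z}. \<Sum>y\<in>R - {z} - {x}. f x y z)"
proof -
  have "(\<Sum>x\<in>R. \<Sum>y\<in>R - {x}. \<Sum>z\<in>R - {x, y}. f x y z) =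
        (\<Sum>x\<in>R. \<Sum>y\<in>R - {x}. \<Sum>z\<in>R - {x} - {y}. f x y z)"
    by (intro sum.cong) auto
  also have "\<dots> = (\<Sum>x\<in>R. \<Sum>z\<in>R - {x}. \<Sum>y\<in>R - {x} - {z}. f x y z)"
    by (intro sum.cong refl sum_swap_distinct) (use assms in auto)
  also have "\<dots> = (\<Sum>z\<in>R. \<Sum>x\<in>R - {z}. \<Sum>y\<in>R - {x} - {z}. f x y z)"
    by (rule sum_swap_distinct) fact
  also have "\<dots> = (\<Sum>z\<in>R. \<Sum>x\<in>R - {z}. \<Sum>y\<in>R - {z} - {x}. f x y z)"
    by (intro sum.cong) auto
  finally show ?thesis .
qed

text \<open>\<open>ok C u v\<close> decides whether the edge may be added to \<open>C\<close>. Upper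
  bounds hold for any such test; how rarely it fails enters through \<open>T_lower\<close>.\<close>

locale interpolation =
  fixes n d :: nat and lam q :: real
    and ok :: "(nat \<times> nat) set \<Rightarrow> nat \<Rightarrow> nat \<Rightarrow> bool"
  assumes lam: "lam > 1" and q: "0 \<le> q" "q \<le> 1" and d: "d > 0"
begin

text \<open>
  Half-edge \<open>h\<close> belongs to vertex \<open>h div d\<close>. \<open>W k R C\<close> is the total weight over all sequences of \<open>k\<close>
  distinct half-edges from \<open>R\<close>, each of which places a warning with probability \<open>q\<close>; \<open>T j k R C\<close>
  first adds a sequence of \<open>j\<close> edges. These are sums, not averages, so that edges and warnings commute
  exactly, and dropping the restriction \<open>ok\<close> on edges can only increase them.
\<close>

primrec W :: "nat \<Rightarrow> nat set \<Rightarrow> (nat \<times> nat) set \<Rightarrow> real" where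
  "W 0 R C = lam ^ alpha n C"
| "W (Suc k) R C = (\<Sum>h\<in>R. q * W k (R - {h}) (insert (h div d, h div d) C) +
                             (1 - q) * W k (R - {h}) C)"

primrec T :: "nat \<Rightarrow> nat \<Rightarrow> nat set \<Rightarrow> (nat \<times> nat) set \<Rightarrow> real" where
  "T 0 k R C = W k R C"
| "T (Suc j) k R C = (\<Sum>x\<in>R. \<Sum>y\<in>R - {x}. if ok C (x div d) (y div d)
      then T j k (R - {x, y}) (insert (x div d, y div d) C) else 0)"

section \<open>Trading one edge for two warnings\<close>

definition cc :: real where "cc = 1 - 1 / lam"
definition bb :: real where "bb = 1 - cc * q\<^sup>2"

lemma cc: "0 < cc" "cc < 1" using lam by (auto simp: cc_def)

lemma bb: "0 < bb"
proof -
  have "cc * q\<^sup>2 \<le> cc * 1"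
    by (intro mult_left_mono power_le_one) (use q cc in auto)
  thus ?thesis using cc unfolding bb_def by linarith
qed

lemma W_nonneg: "0 \<le> W k R C"
  by (induction k arbitrary: R C) (use lam q in \<open>auto intro!: sum_nonneg add_nonneg_nonneg mult_nonneg_nonneg\<close>)

lemma T_nonneg: "0 \<le> T j k R C"
  by (induction j arbitrary: R C) (auto intro!: sum_nonneg simp: W_nonneg split: if_splits)

text \<open>The exchange bounds edges from above and warnings from below: an edge between frozen
  vertices costs at least one, a warning at most one (\<open>pow_alpha_loop\<close>).\<close>

lemma pow_alpha_edge:
  "lam ^ alpha n (insert (u, v) C) \<le>
    lam ^ alpha n C * (1 - cc * (of_bool (u \<in> frozen n C) * of_bool (v \<in> frozen n C)))"
proof (cases "u \<in> frozen n C \<and> v \<in> frozen n C")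
  case True
  then obtain m where m: "alpha n C = Suc m" "alpha n (insert (u, v) C) \<le> m"
    using alpha_insert_frozen[of u n C v] by (cases "alpha n C") auto
  have "lam ^ alpha n (insert (u, v) C) \<le> lam ^ m"
    by (intro power_increasing) (use lam m in auto)
  thus ?thesis using True m lam by (simp add: cc_def field_simps)
next
  case False
  thus ?thesis using lam alpha_insert_le[of n "(u, v)" C] by (auto intro!: power_increasing)
qed

lemma pow_alpha_loop:
  "lam ^ alpha n C * (1 - cc * of_bool (v \<in> frozen n C)) \<le> lam ^ alpha n (insert (v, v) C)"
proof (cases "v \<in> frozen n C")
  case True
  have "lam ^ alpha n C \<le> lam ^ (alpha n (insert (v, v) C) + 1)"
    by (intro power_increasing) (use lam alpha_le_insert_loop in auto)
  thus ?thesis using lam True by (simp add: cc_def field_simps)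
qed (simp add: alpha_insert_loop_unfrozen)

text \<open>With \<open>r\<close> half-edges, \<open>f\<close> of them at frozen vertices (a count
  here, not a fraction), \<open>r^2 - cc f^2 = 2 r (r - cc q f) - bb r^2 - cc (f - q r)^2\<close>,
  and the square is dropped.\<close>

lemma edge_step_base:
  assumes "finite R"
  shows "(\<Sum>x\<in>R. \<Sum>y\<in>R - {x}. W 0 (R - {x, y}) (insert (x div d, y div d) C)) \<le>
    2 * real (card R) * W (Suc 0) R C - bb * (real (card R))\<^sup>2 * W 0 R C"
proof -
  define F where "F x = (of_bool (x div d \<in> frozen n C) :: real)" for x
  define L where "L = lam ^ alpha n C"
  define f where "f = (\<Sum>x\<in>R. F x)"
  define r where "r = real (card R)"
  have L: "L > 0" using lam by (simp add: L_def)
  have F01: "0 \<le> F x" "F x \<le> 1" for x by (auto simp: F_def)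
  have nn: "0 \<le> 1 - cc * (F x * F y)" for x y
  proof -
    have "cc * (F x * F y) \<le> 1 * (1 * 1)"
      by (intro mult_mono) (use cc F01 in auto)
    thus ?thesis by simp
  qed
  have "(\<Sum>x\<in>R. \<Sum>y\<in>R - {x}. W 0 (R - {x, y}) (insert (x div d, y div d) C)) \<le>
        (\<Sum>x\<in>R. \<Sum>y\<in>R - {x}. L * (1 - cc * (F x * F y)))"
    using pow_alpha_edge by (intro sum_mono) (auto simp: L_def F_def)
  also have "\<dots> \<le> (\<Sum>x\<in>R. \<Sum>y\<in>R. L * (1 - cc * (F x * F y)))"
    by (intro sum_mono sum_mono2) (use assms L nn in auto)
  also have "\<dots> = L * (r\<^sup>2 - cc * f\<^sup>2)"
  proof -
    have "(\<Sum>x\<in>R. \<Sum>y\<in>R. L * (1 - cc * (F x * F y))) =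
          L * ((\<Sum>x\<in>R. \<Sum>y\<in>R. 1) - cc * (\<Sum>x\<in>R. \<Sum>y\<in>R. F x * F y))"
      by (simp add: sum_subtractf sum_distrib_left right_diff_distrib)
    thus ?thesis
      by (simp add: f_def r_def power2_eq_square sum_product)
  qed
  also have "\<dots> \<le> 2 * r * (L * (r - cc * q * f)) - bb * r\<^sup>2 * L"
  proof -
    have "2 * r * (L * (r - cc * q * f)) - bb * r\<^sup>2 * L - L * (r\<^sup>2 - cc * f\<^sup>2) =
          L * cc * (f - q * r)\<^sup>2"
      by (simp add: bb_def algebra_simps power2_eq_square)
    moreover have "0 \<le> L * cc * (f - q * r)\<^sup>2" using L cc by auto
    ultimately show ?thesis by simp
  qed
  also have "\<dots> \<le> 2 * r * W (Suc 0) R C - bb * r\<^sup>2 * W 0 R C"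
  proof -
    have "L * (r - cc * q * f) = (\<Sum>h\<in>R. q * (L * (1 - cc * F h)) + (1 - q) * L)"
      by (simp add: f_def r_def sum.distrib sum_subtractf sum_distrib_left algebra_simps)
    also have "\<dots> \<le> W (Suc 0) R C"
      unfolding W.simps L_def F_def
      by (intro sum_mono add_mono mult_left_mono pow_alpha_loop order_refl) (use q in auto)
    finally have "L * (r - cc * q * f) \<le> W (Suc 0) R C" .
    hence "2 * r * (L * (r - cc * q * f)) \<le> 2 * r * W (Suc 0) R C"
      by (intro mult_left_mono) (auto simp: r_def)
    thus ?thesis by (simp add: L_def)
  qed
  finally show ?thesis by (simp add: r_def)
qed

text \<open>Drawing one warning first lowers \<open>card R\<close> and \<open>k\<close> by one each,
  so the coefficients agree in all summands. The bound is linear in \<open>W\<close> so that it can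
  be summed; the product form comes in \<open>edge_step_mult\<close>.\<close>

lemma edge_step_W:
  assumes "finite R" "k \<le> card R"
  shows "(\<Sum>x\<in>R. \<Sum>y\<in>R - {x}. W k (R - {x, y}) (insert (x div d, y div d) C)) \<le>
    2 * real (card R - k) * W (Suc k) R C - bb * (real (card R - k))\<^sup>2 * W k R C"
  using assms
proof (induction k arbitrary: R C)
  case 0
  thus ?case using edge_step_base by simp
next
  case (Suc k)
  define r where "r = real (card R - Suc k)"
  define E where "E R C = (\<Sum>x\<in>R. \<Sum>y\<in>R - {x}. W k (R - {x, y}) (insert (x div d, y div d) C))" for R C
  have IH: "E (R - {h}) C' \<le> 2 * r * W (Suc k) (R - {h}) C' - bb * r\<^sup>2 * W k (R - {h}) C'"
    if "h \<in> R" for h C'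
  proof -
    have c: "card (R - {h}) = card R - 1" using that Suc.prems by simp
    have "k \<le> card (R - {h})" using Suc.prems c by simp
    from Suc.IH[OF _ this, of C'] Suc.prems c show ?thesis by (simp add: r_def E_def)
  qed
  have "(\<Sum>x\<in>R. \<Sum>y\<in>R - {x}. W (Suc k) (R - {x, y}) (insert (x div d, y div d) C)) =
    (\<Sum>x\<in>R. \<Sum>y\<in>R - {x}. \<Sum>h\<in>R - {x, y}.
       q * W k (R - {x, y} - {h}) (insert (h div d, h div d) (insert (x div d, y div d) C)) +
       (1 - q) * W k (R - {x, y} - {h}) (insert (x div d, y div d) C))"
    by simp
  also have "\<dots> = (\<Sum>h\<in>R. \<Sum>x\<in>R - {h}. \<Sum>y\<in>R - {h} - {x}.
       q * W k (R - {x, y} - {h}) (insert (h div d, h div d) (insert (x div d, y div d) C)) +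
       (1 - q) * W k (R - {x, y} - {h}) (insert (x div d, y div d) C))"
    by (rule sum_rotate_distinct) (use Suc.prems in auto)
  also have "\<dots> = (\<Sum>h\<in>R. q * E (R - {h}) (insert (h div d, h div d) C) + (1 - q) * E (R - {h}) C)"
  proof (intro sum.cong refl)
    fix h
    have *: "R - {x, y} - {h} = R - {h} - {x, y}" for x y by auto
    show "(\<Sum>x\<in>R - {h}. \<Sum>y\<in>R - {h} - {x}.
       q * W k (R - {x, y} - {h}) (insert (h div d, h div d) (insert (x div d, y div d) C)) +
       (1 - q) * W k (R - {x, y} - {h}) (insert (x div d, y div d) C)) =
       q * E (R - {h}) (insert (h div d, h div d) C) + (1 - q) * E (R - {h}) C"
      unfolding E_def * insert_commute[of "(h div d, h div d)"]
      by (simp add: sum.distrib sum_distrib_left)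
  qed
  also have "\<dots> \<le> (\<Sum>h\<in>R. q * (2 * r * W (Suc k) (R - {h}) (insert (h div d, h div d) C) -
         bb * r\<^sup>2 * W k (R - {h}) (insert (h div d, h div d) C)) +
       (1 - q) * (2 * r * W (Suc k) (R - {h}) C - bb * r\<^sup>2 * W k (R - {h}) C))"
    using q by (intro sum_mono add_mono mult_left_mono IH) auto
  also have "\<dots> = 2 * r * W (Suc (Suc k)) R C - bb * r\<^sup>2 * W (Suc k) R C"
    unfolding W.simps(2)[of "Suc k" R C] W.simps(2)[of k R C] sum_distrib_left sum_subtractf[symmetric]
    by (intro sum.cong refl) (simp only: algebra_simps)
  finally show ?case by (simp add: r_def)
qed

lemma card_Diff_pair:
  assumes "finite R" "x \<in> R" "y \<in> R - {x}"
  shows "card (R - {x, y}) = card R - 2"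
  using assms by (auto simp: card_Diff_subset)

text \<open>The edge traded is the last one. The earlier ones keep their \<open>ok\<close> test, and
  each lowers \<open>card R\<close> by two, which leaves the coefficients fixed.\<close>

lemma edge_step:
  assumes "finite R" "2 * j + k \<le> card R"
  shows "T (Suc j) k R C \<le> 2 * real (card R - 2 * j - k) * T j (Suc k) R C -
    bb * (real (card R - 2 * j - k))\<^sup>2 * T j k R C"
  using assms
proof (induction j arbitrary: R C)
  case 0
  have "T (Suc 0) k R C \<le> (\<Sum>x\<in>R. \<Sum>y\<in>R - {x}. W k (R - {x, y}) (insert (x div d, y div d) C))"
    by (auto intro!: sum_mono simp: W_nonneg split: if_splits)
  also have "\<dots> \<le> 2 * real (card R - k) * W (Suc k) R C - bb * (real (card R - k))\<^sup>2 * W k R C"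
    by (rule edge_step_W) (use 0 in auto)
  finally show ?case by simp
next
  case (Suc j)
  define r where "r = real (card R - 2 * Suc j - k)"
  have IH: "T (Suc j) k (R - {x, y}) C' \<le> 2 * r * T j (Suc k) (R - {x, y}) C' -
      bb * r\<^sup>2 * T j k (R - {x, y}) C'" if "x \<in> R" "y \<in> R - {x}" for x y C'
    using Suc.IH[of "R - {x, y}" C'] Suc.prems card_Diff_pair[OF _ that] by (simp add: r_def)
  have "T (Suc (Suc j)) k R C \<le> (\<Sum>x\<in>R. \<Sum>y\<in>R - {x}.
      2 * r * (if ok C (x div d) (y div d)
        then T j (Suc k) (R - {x, y}) (insert (x div d, y div d) C) else 0) -
      bb * r\<^sup>2 * (if ok C (x div d) (y div d)
        then T j k (R - {x, y}) (insert (x div d, y div d) C) else 0))"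
    unfolding T.simps(2)[of "Suc j"]
    by (intro sum_mono) (use IH in auto)
  also have "\<dots> = 2 * r * T (Suc j) (Suc k) R C - bb * r\<^sup>2 * T (Suc j) k R C"
    unfolding T.simps(2)[of j] by (simp add: sum_subtractf sum_distrib_left)
  finally show ?case by (simp add: r_def)
qed

text \<open>Multiplying by \<open>bb * x\<close> and completing the square removes the number
  \<open>r\<close> of free half-edges. Taking logarithms gives the step hypothesis of
  \<open>second_difference_window\<close>.\<close>

lemma edge_step_mult:
  assumes "finite R" "2 * j + k \<le> card R"
  shows "bb * (T (Suc j) k R C * T j k R C) \<le> (T j (Suc k) R C)\<^sup>2"
proof -
  define r where "r = real (card R - 2 * j - k)"
  define x where "x = T j k R C"
  define y where "y = T j (Suc k) R C"
  have "T (Suc j) k R C \<le> 2 * r * y - bb * r\<^sup>2 * x"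
    unfolding r_def x_def y_def by (rule edge_step) fact+
  hence "bb * x * T (Suc j) k R C \<le> bb * x * (2 * r * y - bb * r\<^sup>2 * x)"
    by (intro mult_left_mono) (use bb T_nonneg in \<open>auto simp: x_def\<close>)
  also have "\<dots> = y\<^sup>2 - (bb * r * x - y)\<^sup>2"
    by (simp add: algebra_simps power2_eq_square)
  also have "\<dots> \<le> y\<^sup>2" by simp
  finally show ?thesis by (simp add: x_def y_def mult_ac)
qed

text \<open>A further warning has \<open>card R - k\<close> possible half-edges and changes the
  weight by a factor between \<open>1 / lam\<close> and \<open>1\<close>. This will make log-weights
  Lipschitz in \<open>k\<close>.\<close>

lemma W_Suc_bounds:
  assumes "finite R" "k \<le> card R"
  shows "real (card R - k) / lam * W k R C \<le> W (Suc k) R C \<and>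
         W (Suc k) R C \<le> real (card R - k) * W k R C"
  using assms
proof (induction k arbitrary: R C)
  case 0
  have lo: "lam ^ alpha n C / lam \<le> lam ^ alpha n (insert (v, v) C)" for v
  proof -
    have "lam ^ alpha n C \<le> lam ^ (alpha n (insert (v, v) C) + 1)"
      by (intro power_increasing) (use lam alpha_le_insert_loop in auto)
    thus ?thesis using lam by (simp add: field_simps)
  qed
  have lo': "lam ^ alpha n C / lam \<le> lam ^ alpha n C" using lam by (simp add: field_simps)
  have up: "lam ^ alpha n (insert (v, v) C) \<le> lam ^ alpha n C" for v
    by (intro power_increasing) (use lam alpha_insert_le in auto)
  have l: "lam ^ alpha n C / lam \<le> q * lam ^ alpha n (insert (v, v) C) + (1 - q) * lam ^ alpha n C" for v
  proof -
    have "lam ^ alpha n C / lam = q * (lam ^ alpha n C / lam) + (1 - q) * (lam ^ alpha n C / lam)"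
      by (simp only: algebra_simps)
    also have "\<dots> \<le> q * lam ^ alpha n (insert (v, v) C) + (1 - q) * lam ^ alpha n C"
      by (intro add_mono mult_left_mono lo lo') (use q in auto)
    finally show ?thesis .
  qed
  have u: "q * lam ^ alpha n (insert (v, v) C) + (1 - q) * lam ^ alpha n C \<le> lam ^ alpha n C" for v
    using mult_left_mono[OF up[of v], of q] q by (simp add: algebra_simps)
  show ?case
    using sum_mono[of R, OF l] sum_mono[of R, OF u] by simp
next
  case (Suc k)
  define r where "r = real (card R - Suc k)"
  have IH: "r / lam * W k (R - {h}) C' \<le> W (Suc k) (R - {h}) C'"
       "W (Suc k) (R - {h}) C' \<le> r * W k (R - {h}) C'"
    if "h \<in> R" for h C'
    using Suc.IH[of "R - {h}" C'] Suc.prems that by (auto simp: r_def)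
  have "r / lam * W (Suc k) R C \<le> W (Suc (Suc k)) R C"
  proof -
    have "r / lam * W (Suc k) R C =
      (\<Sum>h\<in>R. q * (r / lam * W k (R - {h}) (insert (h div d, h div d) C)) +
             (1 - q) * (r / lam * W k (R - {h}) C))"
      unfolding W.simps(2)[of k R C] sum_distrib_left
      by (intro sum.cong refl) (simp only: algebra_simps)
    also have "\<dots> \<le> W (Suc (Suc k)) R C"
      unfolding W.simps(2)[of "Suc k"]
      by (intro sum_mono add_mono mult_left_mono IH) (use q in auto)
    finally show ?thesis .
  qed
  moreover have "W (Suc (Suc k)) R C \<le> r * W (Suc k) R C"
  proof -
    have "W (Suc (Suc k)) R C \<le>
      (\<Sum>h\<in>R. q * (r * W k (R - {h}) (insert (h div d, h div d) C)) +
             (1 - q) * (r * W k (R - {h}) C))"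
      unfolding W.simps(2)[of "Suc k"]
      by (intro sum_mono add_mono mult_left_mono IH) (use q in auto)
    also have "\<dots> = r * W (Suc k) R C"
      unfolding W.simps(2)[of k R C] sum_distrib_left
      by (intro sum.cong refl) (simp only: algebra_simps)
    finally show ?thesis .
  qed
  ultimately show ?case by (simp add: r_def)
qed

lemma T_Suc_bounds:
  assumes "finite R" "2 * j + k \<le> card R"
  shows "real (card R - 2 * j - k) / lam * T j k R C \<le> T j (Suc k) R C \<and>
         T j (Suc k) R C \<le> real (card R - 2 * j - k) * T j k R C"
  using assms
proof (induction j arbitrary: R C)
  case 0
  thus ?case using W_Suc_bounds[of R k C] by simp
next
  case (Suc j)
  define r where "r = real (card R - 2 * Suc j - k)"
  have IH: "r / lam * T j k (R - {x, y}) C' \<le> T j (Suc k) (R - {x, y}) C'"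
       "T j (Suc k) (R - {x, y}) C' \<le> r * T j k (R - {x, y}) C'"
    if "x \<in> R" "y \<in> R - {x}" for x y C'
    using Suc.IH[of "R - {x, y}" C'] Suc.prems card_Diff_pair[OF _ that] by (auto simp: r_def)
  have "r / lam * T (Suc j) k R C \<le> T (Suc j) (Suc k) R C"
    unfolding T.simps(2) sum_distrib_left by (intro sum_mono) (use IH in auto)
  moreover have "T (Suc j) (Suc k) R C \<le> r * T (Suc j) k R C"
    unfolding T.simps(2) sum_distrib_left by (intro sum_mono) (use IH in auto)
  ultimately show ?case by (simp add: r_def)
qed

end

text \<open>
  Here \<open>u j k\<close> is the normalised log-weight after \<open>j\<close> edges and \<open>k\<close> warnings. The hypothesis bounds
  \<open>u (j + 1) k\<close> by \<open>2 u j (k + 1) - u j k\<close>, whereas \<open>u j (k + 2)\<close> is wanted. The error is a second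
  difference in \<open>k\<close>; its sum over a window of length \<open>L\<close> telescopes and so does not grow with \<open>L\<close>.
\<close>

lemma second_difference_window:
  fixes u :: "nat \<Rightarrow> nat \<Rightarrow> real"
  assumes lip: "\<And>j k. 2 * j + k < K \<Longrightarrow> \<bar>u j (Suc k) - u j k\<bar> \<le> B"
    and step: "\<And>j k. 2 * Suc j + k \<le> K \<Longrightarrow> u (Suc j) k + u j k \<le> 2 * u j (Suc k)"
    and K: "2 * M + L \<le> K" and B: "B \<ge> 0"
  shows "real L * u M 0 \<le> real L * u 0 (2 * M) + 2 * B * real M + 2 * B * (real L)\<^sup>2"
proof -
  define S where "S j s = (\<Sum>i<L. u j (s + i))" for j s
  have S_shift: "S j (Suc s) = S j s + u j (s + L) - u j s" for j s
  proof -
    have "(\<Sum>i<Suc L. u j (s + i)) = u j s + S j (Suc s)"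
      by (subst sum.lessThan_Suc_shift) (simp add: S_def)
    thus ?thesis by (simp add: S_def)
  qed
  \<comment> \<open>Summed over the window, the hypothesis leaves a second difference of
    \<open>S j\<close>. It telescopes to a difference of two increments of \<open>u j\<close>, each
    at most \<open>B\<close> in absolute value.\<close>
  have S_step: "S (Suc j) s \<le> S j (s + 2) + 2 * B" if "2 * Suc j + s + L \<le> K" for j s
  proof -
    have "S (Suc j) s + S j s \<le> 2 * S j (Suc s)"
      unfolding S_def sum_distrib_left sum.distrib[symmetric]
    proof (intro sum_mono)
      fix i assume "i \<in> {..<L}"
      thus "u (Suc j) (s + i) + u j (s + i) \<le> 2 * u j (Suc s + i)"
        using step[of j "s + i"] that by simp
    qed
    moreover have "S j (s + 2) = S j (Suc s) + u j (Suc s + L) - u j (Suc s)"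
      using S_shift[of j "Suc s"] by simp
    moreover note S_shift[of j s]
    moreover have "\<bar>u j (Suc s + L) - u j (s + L)\<bar> \<le> B" "\<bar>u j (Suc s) - u j s\<bar> \<le> B"
      using lip[of j "s + L"] lip[of j s] that by auto
    ultimately show ?thesis by linarith
  qed
  have "S M 0 \<le> S (M - m) (2 * m) + 2 * B * real m" if "m \<le> M" for m
    using that
  proof (induction m)
    case (Suc m)
    have "S (Suc (M - Suc m)) (2 * m) \<le> S (M - Suc m) (2 * m + 2) + 2 * B"
      by (rule S_step) (use Suc.prems K in auto)
    moreover have "Suc (M - Suc m) = M - m" using Suc.prems by simp
    ultimately show ?case using Suc by (simp add: algebra_simps)
  qed simp
  from this[of M] have main: "S M 0 \<le> S 0 (2 * M) + 2 * B * real M" by simp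
  have drift: "\<bar>u j (s + i) - u j s\<bar> \<le> B * real i" if "2 * j + s + i \<le> K" for j s i
    using that
  proof (induction i)
    case (Suc i)
    have "\<bar>u j (s + i) - u j s\<bar> \<le> B * real i" by (rule Suc.IH) (use Suc.prems in simp)
    moreover have "\<bar>u j (Suc (s + i)) - u j (s + i)\<bar> \<le> B"
      by (rule lip) (use Suc.prems in simp)
    ultimately show ?case by (simp add: algebra_simps)
  qed simp
  \<comment> \<open>Inside a window \<open>u\<close> drifts by at most \<open>B * L\<close>, so
    \<open>S\<close> is close to \<open>L\<close> times its first term.\<close>
  have win: "\<bar>S j s - real L * u j s\<bar> \<le> B * (real L)\<^sup>2" if "2 * j + s + L \<le> K" for j s
  proof -
    have "S j s - real L * u j s = (\<Sum>i<L. u j (s + i) - u j s)"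
      by (simp add: S_def sum_subtractf)
    also have "\<bar>\<dots>\<bar> \<le> (\<Sum>i<L. B * real L)"
    proof (intro order_trans[OF sum_abs] sum_mono)
      fix i assume i: "i \<in> {..<L}"
      have "\<bar>u j (s + i) - u j s\<bar> \<le> B * real i" by (rule drift) (use that i in simp)
      also have "\<dots> \<le> B * real L" by (intro mult_left_mono) (use i B in auto)
      finally show "\<bar>u j (s + i) - u j s\<bar> \<le> B * real L" .
    qed
    also have "\<dots> = B * (real L)\<^sup>2" by (simp add: power2_eq_square)
    finally show ?thesis .
  qed
  from win[of M 0] win[of 0 "2 * M"] main K show ?thesis by simp
qed

text \<open>Two consecutive factors are bounded by the square of the larger. In this form the count
  of warning sequences nearly cancels that of edge sequences from \<open>T_lower\<close>.\<close>

lemma fact_le_fact_mult_squares: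
  assumes "2 * m \<le> N"
  shows "fact N \<le> fact (N - 2 * m) * (\<Prod>i<m. (real (N - 2 * i))\<^sup>2)"
  using assms
proof (induction m)
  case (Suc m)
  define r where "r = N - 2 * Suc m"
  have r: "N - 2 * m = Suc (Suc r)" using Suc.prems by (simp add: r_def)
  have "(fact (N - 2 * m) :: real) = real (Suc (Suc r)) * (real (Suc r) * fact r)"
    unfolding r by (simp add: mult_ac)
  also have "\<dots> \<le> real (Suc (Suc r)) * (real (Suc (Suc r)) * fact r)"
    by (intro mult_left_mono mult_right_mono) auto
  also have "\<dots> = fact r * (real (N - 2 * m))\<^sup>2"
    unfolding r by (simp only: power2_eq_square mult_ac)
  finally have "(fact (N - 2 * m) :: real) \<le> fact r * (real (N - 2 * m))\<^sup>2" .
  hence "fact (N - 2 * m) * (\<Prod>i<m. (real (N - 2 * i))\<^sup>2) \<le>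
         fact r * (real (N - 2 * m))\<^sup>2 * (\<Prod>i<m. (real (N - 2 * i))\<^sup>2)"
    by (intro mult_right_mono prod_nonneg) auto
  with Suc show ?case by (simp add: r_def mult_ac)
qed simp

section \<open>Exact weight with warnings only\<close>

lemma alpha_loops: "alpha n ((\<lambda>v. (v, v)) ` Q) = card ({..<n} - Q)"
proof -
  have "{..<n} - Q \<in> indep_sets n ((\<lambda>v. (v, v)) ` Q)"
    by (auto simp: indep_sets_def)
  moreover have "card S \<le> card ({..<n} - Q)" if "S \<in> indep_sets n ((\<lambda>v. (v, v)) ` Q)" for S
    by (rule card_mono) (use that in \<open>auto simp: indep_sets_def\<close>)
  ultimately show ?thesis
    by (metis alpha_attained card_le_alpha order_antisym)
qed

context interpolation
begin

text \<open>Mean weight of one vertex: \<open>lam\<close> if none of its \<open>d\<close> half-edges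
  places a warning, and \<open>1\<close> otherwise.\<close>

definition ww :: real where "ww = 1 + (lam - 1) * (1 - q) ^ d"

lemma ww: "ww \<ge> 1"
  using lam q by (auto simp: ww_def)

text \<open>As all of \<open>R\<close> is used, each of the \<open>fact (card R)\<close> orders
  contributes the same product. \<open>Q\<close> and a partial \<open>R\<close> serve the induction:
  the half-edge \<open>h\<close> affects only the factor of \<open>h div d\<close>.\<close>

lemma W_full_gen:
  assumes "finite R" "\<And>h. h \<in> R \<Longrightarrow> h div d < n"
  shows "W (card R) R ((\<lambda>v. (v, v)) ` Q) = fact (card R) *
    (\<Prod>v<n. if v \<in> Q then 1 else 1 + (lam - 1) * (1 - q) ^ card {h \<in> R. h div d = v})"
  using assms
proof (induction "card R" arbitrary: R Q)
  case 0
  hence R: "R = {}" by auto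
  have "(\<Prod>v<n. if v \<in> Q then 1 else lam) = lam ^ card ({..<n} - Q)"
    by (simp add: prod.If_cases Diff_eq)
  thus ?case unfolding R by (simp add: alpha_loops cong: if_cong)
next
  case (Suc m)
  define w where "w R Q v = (if v \<in> Q then 1 else 1 + (lam - 1) * (1 - q) ^ card {h \<in> R. h div d = v})"
    for R Q and v :: nat
  define G where "G R Q = (\<Prod>v<n. w R Q v)" for R Q
  have IH: "W m (R - {h}) ((\<lambda>v. (v, v)) ` Q') = fact m * G (R - {h}) Q'" if "h \<in> R" for h Q'
  proof -
    have m: "m = card (R - {h})" using Suc.hyps(2) Suc.prems that by simp
    from Suc.hyps(1)[OF m, of Q'] Suc.prems show ?thesis
      unfolding m[symmetric] by (simp add: G_def w_def)
  qed
  have rec: "q * G (R - {h}) (insert (h div d) Q) + (1 - q) * G (R - {h}) Q = G R Q" if h: "h \<in> R" for h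
  proof -
    define v where "v = h div d"
    have v: "v < n" using Suc.prems h by (simp add: v_def)
    define P where "P = (\<Prod>u\<in>{..<n} - {v}. w R Q u)"
    have G_split: "G R' Q' = w R' Q' v * (\<Prod>u\<in>{..<n} - {v}. w R' Q' u)" for R' Q'
      unfolding G_def by (rule prod.remove) (use v in auto)
    have same: "{h' \<in> R - {h}. h' div d = u} = {h' \<in> R. h' div d = u}" if "u \<noteq> v" for u
      using that by (auto simp: v_def)
    have P1: "(\<Prod>u\<in>{..<n} - {v}. w (R - {h}) Q u) = P"
      unfolding P_def
    proof (intro prod.cong refl)
      fix u assume "u \<in> {..<n} - {v}"
      hence "u \<noteq> v" by simp
      thus "w (R - {h}) Q u = w R Q u" unfolding w_def same[OF \<open>u \<noteq> v\<close>] by simp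
    qed
    have P2: "(\<Prod>u\<in>{..<n} - {v}. w (R - {h}) (insert v Q) u) = P"
      unfolding P1[symmetric] by (intro prod.cong refl) (auto simp: w_def)
    have "{h' \<in> R. h' div d = v} = insert h {h' \<in> R - {h}. h' div d = v}"
      using h by (auto simp: v_def)
    hence c: "card {h' \<in> R. h' div d = v} = Suc (card {h' \<in> R - {h}. h' div d = v})"
      using Suc.prems by simp
    have "q * w (R - {h}) (insert v Q) v + (1 - q) * w (R - {h}) Q v = w R Q v"
      by (simp add: w_def c algebra_simps)
    hence "(q * w (R - {h}) (insert v Q) v + (1 - q) * w (R - {h}) Q v) * P = w R Q v * P"
      by simp
    thus ?thesis
      unfolding G_split v_def[symmetric] P1 P2 by (simp add: P_def algebra_simps)
  qed
  have "W (card R) R ((\<lambda>v. (v, v)) ` Q) =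
    (\<Sum>h\<in>R. q * W m (R - {h}) ((\<lambda>v. (v, v)) ` insert (h div d) Q) +
            (1 - q) * W m (R - {h}) ((\<lambda>v. (v, v)) ` Q))"
    unfolding Suc.hyps(2)[symmetric] by simp
  also have "\<dots> = (\<Sum>h\<in>R. fact m * (q * G (R - {h}) (insert (h div d) Q) + (1 - q) * G (R - {h}) Q))"
    by (intro sum.cong refl) (simp only: IH algebra_simps)
  also have "\<dots> = (\<Sum>h\<in>R. fact m * G R Q)"
    by (intro sum.cong refl) (simp only: rec)
  also have "\<dots> = fact (card R) * G R Q"
    unfolding Suc.hyps(2)[symmetric] by (simp add: Suc.hyps(2)[symmetric])
  finally show ?case by (simp add: G_def w_def)
qed

lemma card_div_fiber: "v < n \<Longrightarrow> card {h \<in> {..<d * n}. h div d = v} = d"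
proof -
  assume v: "v < n"
  have "{h \<in> {..<d * n}. h div d = v} = {v * d..<v * d + d}"
  proof (intro set_eqI iffI)
    fix h assume "h \<in> {v * d..<v * d + d}"
    hence h: "v * d \<le> h" "h < Suc v * d" by auto
    moreover have "h div d = v" using h by (intro div_nat_eqI) (auto simp: mult.commute[of d])
    moreover have "Suc v * d \<le> n * d" using v by (intro mult_right_mono) auto
    ultimately show "h \<in> {h \<in> {..<d * n}. h div d = v}" by (auto simp: mult.commute)
  next
    fix h assume "h \<in> {h \<in> {..<d * n}. h div d = v}"
    thus "h \<in> {v * d..<v * d + d}"
      using dividend_less_div_times[OF d, of h] by (auto simp: ac_simps)
  qed
  thus ?thesis by simp
qed

lemma W_full: "W (d * n) {..<d * n} {} = fact (d * n) * ww ^ n"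
proof -
  have "h div d < n" if "h \<in> {..<d * n}" for h
    using that d by (simp add: less_mult_imp_div_less mult.commute)
  from W_full_gen[OF finite_lessThan this, where Q = "{}"] show ?thesis
    by (simp add: card_div_fiber[simplified] ww_def)
qed

text \<open>The exact value is known when all half-edges are used. Stopping \<open>m\<close>
  warnings earlier costs at most \<open>lam\<close> for each; \<open>fact m\<close> counts the
  orders of the missing ones.\<close>

lemma W_tail:
  assumes "finite R" "m \<le> card R"
  shows "fact m * W (card R - m) R C \<le> lam ^ m * W (card R) R C"
  using assms(2)
proof (induction m)
  case (Suc m)
  have *: "Suc (card R - Suc m) = card R - m" "card R - (card R - Suc m) = Suc m"
    using Suc.prems by auto
  have "real (Suc m) / lam * W (card R - Suc m) R C \<le> W (card R - m) R C"
    using W_Suc_bounds[of R "card R - Suc m" C] assms(1) unfolding * by simp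
  hence "lam * fact m * (real (Suc m) / lam * W (card R - Suc m) R C) \<le>
         lam * fact m * W (card R - m) R C"
    by (intro mult_left_mono) (use lam in auto)
  also have "\<dots> \<le> lam * (lam ^ m * W (card R) R C)"
    using Suc lam by simp
  finally show ?case using lam by (simp add: mult_ac)
qed simp

text \<open>Every reachable configuration weighs at least \<open>lam ^ a\<close>, and each edge has
  all choices of \<open>x\<close> and all but at most \<open>D\<close> of \<open>y\<close>.\<close>

lemma T_lower:
  fixes Inv :: "(nat \<times> nat) set \<Rightarrow> nat set \<Rightarrow> bool" and D a :: nat
  assumes step: "\<And>C R x y. Inv C R \<Longrightarrow> x \<in> R \<Longrightarrow> y \<in> R \<Longrightarrow> x \<noteq> y \<Longrightarrow> ok C (x div d) (y div d) \<Longrightarrow>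
      Inv (insert (x div d, y div d) C) (R - {x, y})"
    and bad: "\<And>C R x. Inv C R \<Longrightarrow> x \<in> R \<Longrightarrow> card {y \<in> R. y = x \<or> \<not> ok C (x div d) (y div d)} \<le> D"
    and a: "\<And>C R. Inv C R \<Longrightarrow> a \<le> alpha n C"
    and "finite R" "Inv C R" "2 * j + D \<le> card R"
  shows "lam ^ a * (\<Prod>i<j. real (card R - 2 * i) * (real (card R - 2 * i) - real D)) \<le> T j 0 R C"
  using assms(4-6)
proof (induction j arbitrary: R C)
  case 0
  thus ?case using lam a[of C R] by (simp add: power_increasing)
next
  case (Suc j)
  define P where "P = lam ^ a *
    (\<Prod>i<j. real (card R - 2 * Suc i) * (real (card R - 2 * Suc i) - real D))"
  have P: "P \<ge> 0"
    unfolding P_def using lam Suc.prems by (intro mult_nonneg_nonneg prod_nonneg) auto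
  have IH: "P \<le> T j 0 (R - {x, y}) (insert (x div d, y div d) C)"
    if xy: "x \<in> R" "y \<in> R - {x}" "ok C (x div d) (y div d)" for x y
  proof -
    have c: "card (R - {x, y}) = card R - 2" by (rule card_Diff_pair) (use Suc.prems xy in auto)
    have "Inv (insert (x div d, y div d) C) (R - {x, y})"
      by (rule step) (use Suc.prems xy in auto)
    from Suc.IH[OF _ this] Suc.prems c show ?thesis by (simp add: P_def)
  qed
  have "lam ^ a * (\<Prod>i<Suc j. real (card R - 2 * i) * (real (card R - 2 * i) - real D)) =
        (\<Sum>x\<in>R. (real (card R) - real D) * P)"
    by (subst prod.lessThan_Suc_shift) (simp add: P_def)
  also have "\<dots> \<le> (\<Sum>x\<in>R. \<Sum>y\<in>R - {x}. if ok C (x div d) (y div d) then P else 0)"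
  proof (intro sum_mono)
    fix x assume x: "x \<in> R"
    define B where "B = {y \<in> R. y = x \<or> \<not> ok C (x div d) (y div d)}"
    have "card B \<le> D" unfolding B_def by (rule bad) (use Suc.prems x in auto)
    moreover have "card (R - B) = card R - card B"
      by (rule card_Diff_subset) (use Suc.prems in \<open>auto simp: B_def\<close>)
    ultimately have "(real (card R) - real D) * P \<le> real (card (R - B)) * P"
      by (intro mult_right_mono) (use P in auto)
    also have "\<dots> = (\<Sum>y\<in>R - B. if ok C (x div d) (y div d) then P else 0)"
      by (simp add: B_def)
    also have "\<dots> \<le> (\<Sum>y\<in>R - {x}. if ok C (x div d) (y div d) then P else 0)"
      by (rule sum_mono2) (use Suc.prems P in \<open>auto simp: B_def\<close>)
    finally show "(real (card R) - real D) * P \<le> (\<Sum>y\<in>R - {x}. if ok C (x div d) (y div d) then P else 0)" .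
  qed
  also have "\<dots> \<le> T (Suc j) 0 R C"
    unfolding T.simps(2) by (intro sum_mono) (use IH in auto)
  finally show ?case .
qed

section \<open>Comparison of the lower and upper bounds\<close>

declare T.simps(2) [simp del] W.simps(2) [simp del]

lemma main_bound:
  fixes Inv :: "(nat \<times> nat) set \<Rightarrow> nat set \<Rightarrow> bool" and D a M L :: nat and \<delta> :: real
  assumes step: "\<And>C R x y. Inv C R \<Longrightarrow> x \<in> R \<Longrightarrow> y \<in> R \<Longrightarrow> x \<noteq> y \<Longrightarrow> ok C (x div d) (y div d) \<Longrightarrow>
      Inv (insert (x div d, y div d) C) (R - {x, y})"
    and bad: "\<And>C R x. Inv C R \<Longrightarrow> x \<in> R \<Longrightarrow> card {y \<in> R. y = x \<or> \<not> ok C (x div d) (y div d)} \<le> D"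
    and a: "\<And>C R. Inv C R \<Longrightarrow> a \<le> alpha n C"
    and Inv: "Inv {} {..<d * n}"
    and \<delta>: "0 < \<delta>" "\<delta> \<le> 1" and n: "n > 0" and L: "L > 0"
    and LM: "\<delta> * real n + 2 * real M + real L \<le> real d * real n"
    and D: "2 * real D \<le> \<delta> * real n"
  shows "real a * ln lam \<le> real n * ln ww - real M * ln bb + (real d * real n - 2 * real M) * ln lam
    + 2 * (ln d + ln lam - ln \<delta>) * (real M / real L + real L) + 2 * real M * real D / (\<delta> * real n)"
proof -
  define U where "U = {..<d * n}"
  define K where "K = 2 * M + L"
  \<comment> \<open>Between \<open>\<delta> * n\<close> and \<open>d * n\<close> half-edges are free
    at each stage and a warning costs at most \<open>lam\<close>; hence \<open>B\<close> bounds an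
    increment of \<open>u\<close> in \<open>k\<close>.\<close>
  define B where "B = ln d + ln lam - ln \<delta>"
  \<comment> \<open>Subtracting \<open>ln n\<close> per half-edge makes increments bounded
    independently of \<open>n\<close>; \<open>j * ln bb\<close> absorbs the price of the
    trades.\<close>
  define u where "u j k = ln (T j k U {}) - real (2 * j + k) * ln n + real j * ln bb" for j k
  have U: "finite U" "card U = d * n" by (auto simp: U_def)
  have \<delta>n: "\<delta> * real n > 0" using \<delta> n by simp
  have rem: "\<delta> * real n \<le> real (d * n - i)" "i < d * n" if "i \<le> K" for i
  proof -
    have "\<delta> * real n + real i \<le> real (d * n)"
      using LM that by (simp add: K_def)
    moreover from this have "real i < real (d * n)" using \<delta>n by linarith
    hence i: "i < d * n" by (simp only: of_nat_less_iff)
    ultimately show "\<delta> * real n \<le> real (d * n - i)"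
      by (simp add: of_nat_diff)
    show "i < d * n" by fact
  qed
  have Tlow: "lam ^ a * (\<Prod>i<j. real (d * n - 2 * i) * (real (d * n - 2 * i) - real D)) \<le> T j 0 U {}"
    if "2 * j \<le> K" for j
  proof -
    have "2 * j + D \<le> card U"
      using rem[OF that] D U(2) by linarith
    from T_lower[of Inv D a, OF step bad a U(1) Inv[folded U_def] this] show ?thesis
      by (simp add: U)
  qed
  have fac: "real (d * n - 2 * i) > 0" "real (d * n - 2 * i) - real D > 0" if "2 * i \<le> K" for i
    using rem[OF that] D \<delta>n by linarith+
  have T_pos: "T j k U {} > 0" if "2 * j + k \<le> K" for j k
    using that
  proof (induction k)
    case 0
    have "0 < lam ^ a * (\<Prod>i<j. real (d * n - 2 * i) * (real (d * n - 2 * i) - real D))"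
      using lam fac 0 by (intro mult_pos_pos prod_pos) auto
    also have "\<dots> \<le> T j 0 U {}" by (rule Tlow) (use 0 in simp)
    finally show ?case .
  next
    case (Suc k)
    have "0 < card U - 2 * j - k" using rem(2)[of "2 * j + k"] U Suc.prems by simp
    hence "0 < real (card U - 2 * j - k)" by (simp only: of_nat_0_less_iff)
    hence "0 < real (card U - 2 * j - k) / lam * T j k U {}"
      using Suc lam by (intro mult_pos_pos divide_pos_pos) auto
    also have "\<dots> \<le> T j (Suc k) U {}"
      using T_Suc_bounds[of U j k "{}"] U Suc.prems rem(2)[of "2 * j + k"] by auto
    finally show ?case .
  qed
  have B0: "ln d \<ge> 0" "ln lam > 0" "ln \<delta> \<le> 0"
    using d lam \<delta> by auto
  have "real L * u M 0 \<le> real L * u 0 (2 * M) + 2 * B * real M + 2 * B * (real L)\<^sup>2"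
  proof (rule second_difference_window)
    fix j k assume jk: "2 * j + k < K"
    define r where "r = real (d * n - (2 * j + k))"
    have r1: "\<delta> * real n \<le> r"
      unfolding r_def by (rule rem) (use jk in simp)
    have "r \<le> real (d * n)" unfolding r_def by (rule of_nat_mono) simp
    with r1 \<delta>n have r: "\<delta> * real n \<le> r" "0 < r" "r \<le> real d * real n"
      by auto
    have "real (d * n - 2 * j - k) = r" by (simp add: r_def)
    hence bnd: "r / lam * T j k U {} \<le> T j (Suc k) U {}" "T j (Suc k) U {} \<le> r * T j k U {}"
      using T_Suc_bounds[of U j k "{}"] U jk rem(2)[of "2 * j + k"] by auto
    have pos: "T j k U {} > 0" "T j (Suc k) U {} > 0" using T_pos jk by auto
    have "ln (r / lam * T j k U {}) \<le> ln (T j (Suc k) U {})"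
      using bnd pos r lam by (intro ln_mono) auto
    hence 1: "ln r - ln lam + ln (T j k U {}) \<le> ln (T j (Suc k) U {})"
      using pos r lam by (simp add: ln_mult ln_div)
    have "ln (T j (Suc k) U {}) \<le> ln (r * T j k U {})"
      using bnd pos r by (intro ln_mono) auto
    hence 2: "ln (T j (Suc k) U {}) \<le> ln r + ln (T j k U {})"
      using pos r by (simp add: ln_mult)
    have "ln (\<delta> * real n) \<le> ln r" using r \<delta>n by (intro ln_mono) auto
    hence 3: "ln \<delta> + ln n \<le> ln r" using \<delta> n by (simp add: ln_mult)
    have "ln r \<le> ln (real d * real n)" using r by (intro ln_mono) auto
    hence 4: "ln r \<le> ln d + ln n" using d n by (simp add: ln_mult)
    show "\<bar>u j (Suc k) - u j k\<bar> \<le> B"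
      using 1 2 3 4 B0 by (simp add: u_def B_def abs_le_iff algebra_simps)
  next
    fix j k assume jk: "2 * Suc j + k \<le> K"
    have pos: "T j k U {} > 0" "T j (Suc k) U {} > 0" "T (Suc j) k U {} > 0"
      using T_pos[of j k] T_pos[of j "Suc k"] T_pos[of "Suc j" k] jk by auto
    have "ln (bb * (T (Suc j) k U {} * T j k U {})) \<le> ln ((T j (Suc k) U {})\<^sup>2)"
      using edge_step_mult[of U j k "{}"] U jk rem(2)[of "2 * j + k"] pos bb
      by (intro ln_mono) auto
    hence "ln bb + ln (T (Suc j) k U {}) + ln (T j k U {}) \<le> 2 * ln (T j (Suc k) U {})"
      using pos bb by (simp add: ln_mult ln_realpow)
    thus "u (Suc j) k + u j k \<le> 2 * u j (Suc k)"
      by (simp add: u_def algebra_simps)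
  qed (use B0 in \<open>auto simp: K_def B_def\<close>)
  also have "\<dots> = real L * (u 0 (2 * M) + 2 * B * (real M / real L + real L))"
    using L by (simp add: algebra_simps power2_eq_square)
  finally have "real L * u M 0 \<le> real L * (u 0 (2 * M) + 2 * B * (real M / real L + real L))" .
  hence "u M 0 \<le> u 0 (2 * M) + 2 * B * (real M / real L + real L)"
    using L by (simp only: mult_le_cancel_left_pos of_nat_0_less_iff)
  hence main: "ln (T M 0 U {}) + real M * ln bb \<le>
      ln (T 0 (2 * M) U {}) + 2 * B * (real M / real L + real L)"
    by (simp add: u_def)
  have MK: "2 * i \<le> K" if "i \<le> M" for i using that by (simp add: K_def)
  define r where "r i = real (d * n - 2 * i)" for i
  have r: "r i > 0" "r i - real D > 0" "\<delta> * real n \<le> r i" if "i < M" for i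
    using fac[OF MK, of i] rem(1)[OF MK, of i] that by (auto simp: r_def)
  have lower: "real a * ln lam + (\<Sum>i<M. ln (r i) + ln (r i - real D)) \<le> ln (T M 0 U {})"
  proof -
    have fpos: "r i * (r i - real D) > 0" if "i \<in> {..<M}" for i
      using r[of i] that by (intro mult_pos_pos) auto
    have "ln (\<Prod>i<M. r i * (r i - real D)) = (\<Sum>i<M. ln (r i * (r i - real D)))"
      by (rule ln_prod) (use fpos in \<open>force\<close>)+
    moreover have "ln (lam ^ a * (\<Prod>i<M. r i * (r i - real D))) =
        ln (lam ^ a) + ln (\<Prod>i<M. r i * (r i - real D))"
      by (intro ln_mult_pos prod_pos) (use lam fpos in auto)
    ultimately have "ln (lam ^ a * (\<Prod>i<M. r i * (r i - real D))) =
          real a * ln lam + (\<Sum>i<M. ln (r i * (r i - real D)))"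
      using lam by (simp add: ln_realpow)
    also have "(\<Sum>i<M. ln (r i * (r i - real D))) = (\<Sum>i<M. ln (r i) + ln (r i - real D))"
      by (intro sum.cong refl ln_mult_pos) (use r in auto)
    finally have "real a * ln lam + (\<Sum>i<M. ln (r i) + ln (r i - real D)) =
        ln (lam ^ a * (\<Prod>i<M. r i * (r i - real D)))" ..
    also have "\<dots> \<le> ln (T M 0 U {})"
      using Tlow[of M] lam r by (intro ln_mono mult_pos_pos prod_pos) (auto simp: K_def r_def)
    finally show ?thesis .
  qed
  have upper: "ln (T 0 (2 * M) U {}) \<le> (\<Sum>i<M. 2 * ln (r i)) + real n * ln ww +
      (real d * real n - 2 * real M) * ln lam"
  proof -
    define m where "m = d * n - 2 * M"
    have Mdn: "2 * M < d * n" by (rule rem(2)) (use MK in auto)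
    hence m: "m \<le> card U" "d * n - m = 2 * M" "real m = real d * real n - 2 * real M"
      by (auto simp: m_def U of_nat_diff)
    define p where "p = (\<Prod>i<M. (r i)\<^sup>2)"
    have pr: "(\<Prod>i<M. (r i)\<^sup>2) > 0"
      using r by (intro prod_pos zero_less_power) auto
    have "fact m * W (2 * M) U {} \<le> lam ^ m * W (d * n) U {}"
      using W_tail[OF U(1) m(1), of "{}"] unfolding U(2) m(2) .
    also have "\<dots> = lam ^ m * (fact (d * n) * ww ^ n)"
      unfolding U_def W_full ..
    also have "\<dots> \<le> lam ^ m * (fact m * (\<Prod>i<M. (r i)\<^sup>2) * ww ^ n)"
      unfolding m_def r_def using lam ww Mdn
      by (intro mult_left_mono mult_right_mono fact_le_fact_mult_squares) auto
    finally have "fact m * W (2 * M) U {} \<le> fact m * (lam ^ m * (\<Prod>i<M. (r i)\<^sup>2) * ww ^ n)"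
      by (simp only: mult_ac)
    hence "W (2 * M) U {} \<le> lam ^ m * (\<Prod>i<M. (r i)\<^sup>2) * ww ^ n"
      by (simp only: mult_le_cancel_left_pos fact_gt_zero)
    hence "ln (T 0 (2 * M) U {}) \<le> ln (lam ^ m * (\<Prod>i<M. (r i)\<^sup>2) * ww ^ n)"
      using T_pos[of 0 "2 * M"] MK[of M] by (intro ln_mono) auto
    also have "\<dots> = ln (lam ^ m) + ln (\<Prod>i<M. (r i)\<^sup>2) + ln (ww ^ n)"
      unfolding p_def[symmetric] using lam ww pr[folded p_def] by (simp add: ln_mult)
    also have "\<dots> = real m * ln lam + ln (\<Prod>i<M. (r i)\<^sup>2) + real n * ln ww"
      using lam ww by (simp add: ln_realpow)
    also have "ln (\<Prod>i<M. (r i)\<^sup>2) = (\<Sum>i<M. ln ((r i)\<^sup>2))"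
      by (rule ln_prod) (use r in \<open>force\<close>)+
    also have "(\<Sum>i<M. ln ((r i)\<^sup>2)) = (\<Sum>i<M. 2 * ln (r i))"
      by (intro sum.cong refl) (use r in \<open>simp add: ln_realpow\<close>)
    finally show ?thesis by (simp add: m(3))
  qed
  have corr: "(\<Sum>i<M. ln (r i) - ln (r i - real D)) \<le> 2 * real M * real D / (\<delta> * real n)"
  proof -
    have "ln (r i) - ln (r i - real D) \<le> 2 * real D / (\<delta> * real n)" if i: "i < M" for i
    proof -
      have ri: "r i > 0" "r i - real D > 0" "r i \<ge> 2 * real D" using r[OF i] D by auto
      have "ln (r i - real D) = ln (r i) + ln (1 - real D / r i)"
      proof -
        have "r i - real D = r i * (1 - real D / r i)" using ri by (simp add: field_simps)
        moreover have "1 - real D / r i > 0" using ri by (simp add: field_simps)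
        ultimately show ?thesis using ri by (simp add: ln_mult)
      qed
      \<comment> \<open>\<open>D / r i\<close> is at most one half, where this quadratic bound
        holds.\<close>
      moreover have "ln (1 - real D / r i) \<ge> - (real D / r i) - 2 * (real D / r i)\<^sup>2"
        using ri by (intro ln_one_minus_pos_lower_bound) (auto simp: field_simps)
      moreover have "2 * (real D / r i)\<^sup>2 \<le> real D / r i"
      proof -
        have "2 * (real D / r i) \<le> 1" using ri by (simp add: field_simps)
        hence "2 * (real D / r i) * (real D / r i) \<le> 1 * (real D / r i)"
          by (intro mult_right_mono) (use ri in auto)
        thus ?thesis by (simp add: power2_eq_square)
      qed
      ultimately have "ln (r i) - ln (r i - real D) \<le> 2 * (real D / r i)" by linarith
      also have "\<dots> \<le> 2 * (real D / (\<delta> * real n))"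
        using r[OF i] \<delta>n by (intro mult_left_mono divide_left_mono) auto
      finally show ?thesis by simp
    qed
    hence "(\<Sum>i<M. ln (r i) - ln (r i - real D)) \<le> (\<Sum>i<M. 2 * real D / (\<delta> * real n))"
      by (intro sum_mono) auto
    thus ?thesis by (simp add: mult_ac)
  qed
  have "(\<Sum>i<M. 2 * ln (r i)) - (\<Sum>i<M. ln (r i) + ln (r i - real D)) =
        (\<Sum>i<M. ln (r i) - ln (r i - real D))"
    by (simp add: sum_subtractf[symmetric])
  with main lower upper corr show ?thesis unfolding B_def by linarith
qed

end

section \<open>Independence ratio of regular graphs of large girth\<close>

definition sparse_graph :: "nat \<Rightarrow> nat \<Rightarrow> nat \<Rightarrow> (nat \<times> nat) set \<Rightarrow> bool" where
  "sparse_graph n d g C \<longleftrightarrow> C \<subseteq> {..<n} \<times> {..<n} \<and> nbgirth (adj C) g \<and>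
     (\<forall>v. \<not> adj C v v) \<and> (\<forall>v<n. card {u. adj C v u} \<le> d)"

text \<open>An edge consumes a free half-edge at either end, so the sum cannot grow and degrees stay
  at most \<open>d\<close>.\<close>

definition degree_budget :: "nat \<Rightarrow> nat \<Rightarrow> (nat \<times> nat) set \<Rightarrow> nat set \<Rightarrow> bool" where
  "degree_budget n d C R \<longleftrightarrow> R \<subseteq> {..<d * n} \<and>
     (\<forall>v<n. card {u. adj C v u} + card {h \<in> R. h div d = v} \<le> d)"

lemma finite_adj:
  fixes n :: nat
  shows "C \<subseteq> {..<n} \<times> {..<n} \<Longrightarrow> finite {u. adj C v u}"
  by (rule finite_subset[of _ "{..<n}"]) (auto simp: adj_def)

lemma sparse_graph_empty: "sparse_graph n d g {}"
proof -
  have "\<not> nbw (adj ({} :: (nat \<times> nat) set)) xs" if "length xs \<ge> 2" for xs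
    using that by (cases "(adj ({} :: (nat \<times> nat) set), xs)" rule: nbw.cases) (auto simp: adj_def)
  thus ?thesis by (auto simp: sparse_graph_def nbgirth_def adj_def)
qed

text \<open>\<open>near\<close> contains the identity, so far vertices are distinct and no loop
  arises; \<open>nbgirth_insert\<close> keeps the girth.\<close>

lemma insert_far_edge:
  assumes C: "sparse_graph n d g C" "degree_budget n d C R" and d: "d > 0"
    and xy: "x \<in> R" "y \<in> R" "x \<noteq> y" and far: "(x div d, y div d) \<notin> near (adj C) g"
  shows "sparse_graph n d g (insert (x div d, y div d) C)"
    and "degree_budget n d (insert (x div d, y div d) C) (R - {x, y})"
proof -
  define u v where "u = x div d" and "v = y div d"
  have R: "R \<subseteq> {..<d * n}" "finite R"
    using C(2) finite_subset by (auto simp: degree_budget_def)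
  have uv: "u < n" "v < n" using R xy d by (auto simp: u_def v_def less_mult_imp_div_less mult.commute)
  have "(u, v) \<in> near (adj C) g" if "u = v"
    using near_mono[of u v "adj C" 0 g] that by simp
  hence ne: "u \<noteq> v" using far by (auto simp: u_def v_def)
  have Cn: "C \<subseteq> {..<n} \<times> {..<n}" using C(1) by (simp add: sparse_graph_def)
  have budget: "card {w. adj (insert (u, v) C) z w} + card {h \<in> R - {x, y}. h div d = z} \<le> d"
    if z: "z < n" for z
  proof -
    have old: "card {w. adj C z w} + card {h \<in> R. h div d = z} \<le> d"
      using C(2) z by (simp add: degree_budget_def)
    consider "z = u" | "z = v" | "z \<noteq> u" "z \<noteq> v" by blast
    thus ?thesis
    proof cases
      case 1
      have "{w. adj (insert (u, v) C) z w} = insert v {w. adj C z w}"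
        using 1 ne by (auto simp: adj_insert)
      hence "card {w. adj (insert (u, v) C) z w} \<le> Suc (card {w. adj C z w})"
        using card_insert_le_m1 finite_adj[OF Cn] by (simp add: card_insert_if)
      moreover have "{h \<in> R. h div d = z} = insert x {h \<in> R - {x, y}. h div d = z}"
        using 1 ne xy by (auto simp: u_def v_def)
      hence "card {h \<in> R. h div d = z} = Suc (card {h \<in> R - {x, y}. h div d = z})"
        using R by simp
      ultimately show ?thesis using old by simp
    next
      case 2
      have "{w. adj (insert (u, v) C) z w} = insert u {w. adj C z w}"
        using 2 ne by (auto simp: adj_insert)
      hence "card {w. adj (insert (u, v) C) z w} \<le> Suc (card {w. adj C z w})"
        using card_insert_le_m1 finite_adj[OF Cn] by (simp add: card_insert_if)
      moreover have "{h \<in> R. h div d = z} = insert y {h \<in> R - {x, y}. h div d = z}"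
        using 2 ne xy by (auto simp: u_def v_def)
      hence "card {h \<in> R. h div d = z} = Suc (card {h \<in> R - {x, y}. h div d = z})"
        using R by simp
      ultimately show ?thesis using old by simp
    next
      case 3
      have "{w. adj (insert (u, v) C) z w} = {w. adj C z w}"
        using 3 by (auto simp: adj_insert)
      moreover have "card {h \<in> R - {x, y}. h div d = z} \<le> card {h \<in> R. h div d = z}"
        by (rule card_mono) (use R in auto)
      ultimately show ?thesis using old by simp
    qed
  qed
  show "degree_budget n d (insert (x div d, y div d) C) (R - {x, y})"
    using budget R unfolding degree_budget_def u_def v_def by auto
  have "card {w. adj (insert (u, v) C) z w} \<le> d" if "z < n" for z
    using budget[OF that] by simp
  thus "sparse_graph n d g (insert (x div d, y div d) C)"
    unfolding sparse_graph_def u_def[symmetric] v_def[symmetric]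
  proof (intro conjI allI impI)
    show "nbgirth (adj (insert (u, v) C)) g"
      using C(1) far by (intro nbgirth_insert) (auto simp: sparse_graph_def u_def v_def)
    show "\<not> adj (insert (u, v) C) z z" for z
      using C(1) ne by (auto simp: sparse_graph_def adj_insert)
  qed (use uv Cn in auto)
qed

text \<open>A ball of radius \<open>g\<close> has at most \<open>Suc d ^ g\<close> vertices with at
  most \<open>d\<close> half-edges each, a bound independent of \<open>n\<close>. The double
  negation matches the form of \<open>ok\<close>.\<close>

lemma card_near_half_edges:
  assumes C: "sparse_graph n d g C" "degree_budget n d C R" and d: "d > 0" and x: "x \<in> R"
  shows "card {y \<in> R. y = x \<or> \<not> (x div d, y div d) \<notin> near (adj C) g} \<le> d * Suc d ^ g"
proof -
  define A where "A = {v. (x div d, v) \<in> near (adj C) g}"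
  have R: "R \<subseteq> {..<d * n}" "finite R"
    using C(2) finite_subset by (auto simp: degree_budget_def)
  have Cn: "C \<subseteq> {..<n} \<times> {..<n}" using C(1) by (simp add: sparse_graph_def)
  have "card {u. adj C v u} \<le> d" for v
  proof (cases "v < n")
    case False
    hence "{u. adj C v u} = {}" using Cn by (auto simp: adj_def)
    thus ?thesis by simp
  qed (use C in \<open>auto simp: sparse_graph_def\<close>)
  hence A: "finite A" "card A \<le> Suc d ^ g"
    unfolding A_def using card_near_le[of "adj C" d "x div d" g] finite_adj[OF Cn] by auto
  have fiber: "card {y \<in> R. y div d = v} \<le> d" for v
  proof (cases "v < n")
    case True
    thus ?thesis using C(2) by (auto simp: degree_budget_def dest: add_leD2)
  next
    case False
    hence "{y \<in> R. y div d = v} = {}"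
      using R d by (auto simp: less_mult_imp_div_less mult.commute)
    thus ?thesis by (simp only: card.empty)
  qed
  have "x div d \<in> A" using near_mono[of "x div d" "x div d" "adj C" 0 g] by (simp add: A_def)
  hence "{y \<in> R. y = x \<or> \<not> (x div d, y div d) \<notin> near (adj C) g} \<subseteq> (\<Union>v\<in>A. {y \<in> R. y div d = v})"
    by (auto simp: A_def)
  hence "card {y \<in> R. y = x \<or> \<not> (x div d, y div d) \<notin> near (adj C) g} \<le>
      card (\<Union>v\<in>A. {y \<in> R. y div d = v})"
    by (intro card_mono) (use A R in auto)
  also have "\<dots> \<le> (\<Sum>v\<in>A. card {y \<in> R. y div d = v})"
    by (rule card_UN_le) (rule A)
  also have "\<dots> \<le> (\<Sum>v\<in>A. d)" by (intro sum_mono fiber)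
  also have "\<dots> \<le> d * Suc d ^ g" using A by simp
  finally show ?thesis .
qed

text \<open>The logarithms are those of \<open>ww\<close> and \<open>bb\<close>;
  \<open>d / 2\<close> is the number of edges per vertex when all half-edges are matched.\<close>

definition rsb_bound :: "nat \<Rightarrow> real \<Rightarrow> real \<Rightarrow> real" where
  "rsb_bound d lam q = (ln (1 + (lam - 1) * (1 - q) ^ d) -
     real d / 2 * ln (1 - (1 - 1 / lam) * q\<^sup>2)) / ln lam"

text \<open>Otherwise every sparse graph would have large \<open>alpha\<close>, against
  \<open>main_bound\<close>. The parameters are fixed in the order \<open>\<delta>\<close>,
  \<open>L\<close>, \<open>n\<close>.\<close>

lemma sparse_graph_alpha:
  fixes lam q \<eta> :: real
  assumes lam: "lam > 1" and q: "0 \<le> q" "q \<le> 1" and d: "d > 0" and \<eta>: "\<eta> > 0"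
  shows "\<exists>n C. n > 0 \<and> sparse_graph n d g C \<and> real (alpha n C) \<le> (rsb_bound d lam q + \<eta>) * real n"
proof -
  define F where "F = rsb_bound d lam q"
  \<comment> \<open>A quarter of the slack: three groups of errors take one each, and the fourth
    makes the inequality strict.\<close>
  define e where "e = \<eta> * ln lam / 4"
  \<comment> \<open>\<open>\<eta> / 8\<close> keeps the linear cost of unmatched half-edges below
    \<open>e * n\<close>; \<open>1 / 2\<close> keeps \<open>d - 2 * \<delta>\<close>
    nonnegative.\<close>
  define \<delta> where "\<delta> = min (1 / 2) (\<eta> / 8)"
  define B where "B = ln d + ln lam - ln \<delta>"
  define D where "D = d * Suc d ^ g"
  define c where "c = 2 * ln lam + real d * real D / \<delta>"
  have lnlam: "ln lam > 0" using lam by simp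
  have e: "e > 0" using lnlam \<eta> by (simp add: e_def)
  have \<delta>: "0 < \<delta>" "\<delta> \<le> 1 / 2" "\<delta> \<le> \<eta> / 8" using \<eta> by (auto simp: \<delta>_def)
  have "ln \<delta> \<le> 0" using \<delta> by simp
  moreover have "ln (real d) \<ge> 0" using d by simp
  ultimately have B: "B \<ge> 0" using lnlam unfolding B_def by linarith
  \<comment> \<open>This \<open>L\<close> brings \<open>2 * B * M / L\<close> below
    \<open>e * n\<close>; the other window cost \<open>2 * B * L\<close> does not grow with
    \<open>n\<close>.\<close>
  obtain L :: nat where L: "real L > B * real d / e" using reals_Archimedean2 by blast
  have "B * real d / e \<ge> 0" using B e by simp
  hence L0: "L > 0" using L by (metis of_nat_0_less_iff order_le_less_trans)
  obtain n :: nat where n: "real n > max (real L / \<delta>) (max (2 * real D / \<delta>) ((c + 2 * B * real L) / e))"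
    using reals_Archimedean2 by blast
  have n1: "real n > real L / \<delta>" "real n > 2 * real D / \<delta>" "real n > (c + 2 * B * real L) / e"
    using n by auto
  have "real L / \<delta> > 0" using L0 \<delta> by simp
  hence n0: "n > 0" using n1(1) by (metis of_nat_0_less_iff order_less_trans)
  have nL: "real L \<le> \<delta> * real n" and nD: "2 * real D \<le> \<delta> * real n"
    and nc: "c + 2 * B * real L \<le> e * real n"
    using n1 \<delta> e by (auto simp: field_simps)
  define a where "a = nat \<lfloor>(F + \<eta>) * real n\<rfloor> + 1"
  \<comment> \<open>About \<open>2 * \<delta> * n\<close> half-edges stay unmatched: half of them
    guarantee free choices, the rest leave room for the window.\<close>
  define M where "M = nat \<lfloor>(real d - 2 * \<delta>) * real n / 2\<rfloor>"
  have "(real d - 2 * \<delta>) * real n / 2 \<ge> 0" using \<delta> d by auto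
  hence M: "real M \<le> (real d - 2 * \<delta>) * real n / 2" "(real d - 2 * \<delta>) * real n / 2 < real M + 1"
    unfolding M_def by linarith+
  have M2: "2 * real M \<le> real d * real n - 2 * \<delta> * real n"
    "real d * real n - 2 * real M \<le> 2 * \<delta> * real n + 2"
    using M by (auto simp: algebra_simps)
  have "2 * \<delta> * real n \<ge> 0" using \<delta> by simp
  hence M3: "2 * real M \<le> real d * real n" using M2 by linarith
  interpret interpolation n d lam q "\<lambda>C u v. (u, v) \<notin> near (adj C) g"
    by unfold_locales (use lam q d in auto)
  have "\<exists>C. sparse_graph n d g C \<and> alpha n C < a"
  proof (rule ccontr)
    assume "\<not> ?thesis"
    hence large: "a \<le> alpha n C" if "sparse_graph n d g C" for C
      using that by (meson not_le)
    define Inv where "Inv C R \<longleftrightarrow> sparse_graph n d g C \<and> degree_budget n d C R" for C R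
    have "Inv {} {..<d * n}"
      using sparse_graph_empty card_div_fiber by (auto simp: Inv_def degree_budget_def adj_def)
    moreover have "\<delta> * real n + 2 * real M + real L \<le> real d * real n"
      using M2 nL by linarith
    ultimately have "real a * ln lam \<le> real n * ln ww - real M * ln bb +
      (real d * real n - 2 * real M) * ln lam + 2 * (ln d + ln lam - ln \<delta>) * (real M / real L + real L) +
      2 * real M * real D / (\<delta> * real n)"
      using insert_far_edge card_near_half_edges large \<delta> n0 L0 nD d
      by (intro main_bound[of Inv D a \<delta> L M]) (auto simp: Inv_def D_def)
    also have "\<dots> \<le> real n * ln ww - (real d * real n / 2) * ln bb + (2 * \<delta> * real n + 2) * ln lam +
        (e * real n + 2 * B * real L) + real d * real D / \<delta>"
    proof -
      have "bb \<le> 1" using cc by (simp add: bb_def)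
      hence "(real d * real n / 2) * ln bb \<le> real M * ln bb"
        using bb M3 by (intro mult_right_mono_neg) auto
      moreover have "(real d * real n - 2 * real M) * ln lam \<le> (2 * \<delta> * real n + 2) * ln lam"
        using M2 lnlam by (intro mult_right_mono) auto
      moreover have "2 * B * (real M / real L + real L) \<le> e * real n + 2 * B * real L"
      proof -
        have "B * real d \<le> e * real L" using L e by (simp add: field_simps)
        hence "B * real d * real n \<le> e * real L * real n" by (intro mult_right_mono) auto
        moreover have "B * (2 * real M) \<le> B * (real d * real n)"
          using B M3 by (intro mult_left_mono)
        ultimately have "2 * B * real M \<le> e * real n * real L" by (simp add: mult_ac)
        hence "2 * B * real M / real L \<le> e * real n" using L0 by (simp add: field_simps)
        thus ?thesis by (simp add: distrib_left)
      qed
      moreover have "2 * real M * real D / (\<delta> * real n) \<le> real d * real D / \<delta>"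
      proof -
        have "2 * real M * real D / (\<delta> * real n) \<le> real d * real n * real D / (\<delta> * real n)"
          using \<delta> M3 by (intro divide_right_mono mult_right_mono) auto
        thus ?thesis using n0 by simp
      qed
      ultimately show ?thesis unfolding B_def by linarith
    qed
    also have "\<dots> = real n * (F * ln lam) + 2 * \<delta> * ln lam * real n + e * real n + (c + 2 * B * real L)"
    proof -
      have F: "F * ln lam = ln ww - real d / 2 * ln bb"
        using lnlam by (simp add: F_def rsb_bound_def ww_def bb_def cc_def)
      show ?thesis unfolding F by (simp add: c_def algebra_simps)
    qed
    also have "\<dots> \<le> real n * (F * ln lam) + e * real n + e * real n + e * real n"
    proof -
      have "2 * \<delta> * ln lam * real n \<le> e * real n"
        unfolding e_def using \<delta> lnlam by (intro mult_right_mono) (auto simp: field_simps)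
      thus ?thesis using nc by linarith
    qed
    also have "\<dots> < (F + \<eta>) * real n * ln lam"
    proof -
      have "(F + \<eta>) * real n * ln lam = real n * (F * ln lam) + 4 * (e * real n)"
        by (simp add: e_def algebra_simps)
      moreover have "e * real n > 0" using e n0 by simp
      ultimately show ?thesis by linarith
    qed
    finally have "real a < (F + \<eta>) * real n" using lnlam by simp
    moreover have "real a > (F + \<eta>) * real n" unfolding a_def by linarith
    ultimately show False by simp
  qed
  then obtain C where C: "sparse_graph n d g C" "alpha n C < a" by blast
  \<comment> \<open>Without this, \<open>nat\<close> in \<open>a\<close> could cut off a negative
    value.\<close>
  have "F \<ge> 0"
  proof -
    have "ln ww \<ge> 0" "ln bb \<le> 0" using ww bb cc by (auto simp: bb_def)
    hence "ln ww - real d / 2 * ln bb \<ge> 0"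
      by (smt (verit) divide_nonneg_nonneg mult_nonneg_nonpos of_nat_0_le_iff)
    thus ?thesis using lnlam by (simp add: F_def rsb_bound_def ww_def bb_def cc_def)
  qed
  hence "(F + \<eta>) * real n \<ge> 0" using \<eta> by simp
  hence "real (alpha n C) \<le> (F + \<eta>) * real n"
    using C(2) unfolding a_def by linarith
  thus ?thesis using C n0 unfolding F_def by blast
qed

lemma regular_graph_small_ratio:
  fixes lam q \<eta> :: real
  assumes "lam > 1" "0 \<le> q" "q \<le> 1" "d > 0" "\<eta> > 0"
  shows "\<exists>V E. simple_graph V E \<and> regular d V E \<and> girth_at_least V E g \<and>
    independence_ratio V E \<le> rsb_bound d lam q + \<eta>"
proof -
  \<comment> \<open>\<open>Suc g\<close> meets the requirement of \<open>regular_completion\<close>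
    that the girth bound be positive, also for \<open>g = 0\<close>.\<close>
  obtain n C where n: "n > 0" and C: "sparse_graph n d (Suc g) C"
    and alpha: "real (alpha n C) \<le> (rsb_bound d lam q + \<eta>) * real n"
    using sparse_graph_alpha[OF assms] by blast
  have Cn: "C \<subseteq> {..<n} \<times> {..<n}" and irr: "\<And>v. \<not> adj C v v" and girth: "nbgirth (adj C) (Suc g)"
    and deg: "\<And>v. v < n \<Longrightarrow> card {u. adj C v u} \<le> d"
    using C by (auto simp: sparse_graph_def)
  have "\<exists>V' E'. simple_graph V' E' \<and> regular d V' E' \<and> girth_at_least V' E' (Suc g) \<and>
    independence_ratio V' E' \<le> real (alpha n C) / real (card {..<n})"
  proof (rule regular_completion[of "{..<n}" "adj C"])
    show "card {u \<in> {..<n}. adj C v u} \<le> d" if "v \<in> {..<n}" for v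
    proof -
      have "{u \<in> {..<n}. adj C v u} = {u. adj C v u}" using Cn by (auto simp: adj_def)
      thus ?thesis using deg that by simp
    qed
    show "card S \<le> alpha n C" if "S \<subseteq> {..<n}" "\<And>u v. u \<in> S \<Longrightarrow> v \<in> S \<Longrightarrow> \<not> adj C u v" for S
      by (rule card_le_alpha) (use that in \<open>auto simp: indep_sets_def adj_def\<close>)
  qed (use n Cn irr girth in \<open>auto simp: adj_def\<close>)
  moreover have "real (alpha n C) / real (card {..<n}) \<le> rsb_bound d lam q + \<eta>"
    using alpha n by (simp add: field_simps)
  moreover have "girth_at_least V E g" if "girth_at_least V E (Suc g)" for V E
    using that by (auto simp: girth_at_least_def dest: Suc_leD)
  ultimately show ?thesis by (meson order_trans)
qed

text \<open>\<open>i_rg d\<close> is nondecreasing and bounded, so it converges and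
  \<open>lim\<close> denotes its limit. Monotonicity of \<open>Inf\<close> relies on each
  \<open>A g\<close> being nonempty.\<close>

theorem i_inf_le_rsb_bound:
  fixes lam q :: real
  assumes par: "lam > 1" "0 \<le> q" "q \<le> 1" "d > 0"
  shows "i_inf d \<le> rsb_bound d lam q"
proof -
  define A where "A g = {independence_ratio V E | V E.
      simple_graph V E \<and> regular d V E \<and> girth_at_least V E g}" for g
  have i_rg: "i_rg d g = Inf (A g)" for g by (simp add: i_rg_def A_def)
  have bdd: "bdd_below (A g)" for g
    by (rule bdd_belowI[of _ 0]) (auto simp: A_def independence_ratio_def)
  have ne: "A g \<noteq> {}" for g
    using regular_graph_small_ratio[OF par zero_less_one, of g] by (auto simp: A_def)
  have le: "i_rg d g \<le> rsb_bound d lam q" for g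
  proof (rule field_le_epsilon)
    fix \<eta> :: real assume "\<eta> > 0"
    from regular_graph_small_ratio[OF par this, of g] obtain x where
      "x \<in> A g" "x \<le> rsb_bound d lam q + \<eta>" by (auto simp: A_def)
    thus "i_rg d g \<le> rsb_bound d lam q + \<eta>"
      unfolding i_rg using cInf_lower[OF _ bdd] by (meson order_trans)
  qed
  have "incseq (i_rg d)"
  proof (rule incseq_SucI)
    fix g
    have "A (Suc g) \<subseteq> A g" by (fastforce simp: A_def girth_at_least_def)
    thus "i_rg d g \<le> i_rg d (Suc g)"
      unfolding i_rg by (intro cInf_superset_mono ne bdd)
  qed
  then obtain l where "i_rg d \<longlonglongrightarrow> l" "\<And>g. i_rg d g \<le> l"
    using incseq_convergent[of "i_rg d" "rsb_bound d lam q"] le by metis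
  moreover from this have "i_inf d = l" unfolding i_inf_def by (simp add: limI)
  ultimately show ?thesis using le by (auto intro: LIMSEQ_le_const2)
qed

text \<open>For \<open>lam = 3\<close> and \<open>q = 1 / 2\<close> the logarithms are of
  \<open>5 / 4\<close> and \<open>5 / 6\<close>, and twice the numerator is
  \<open>3 * ln 3 - ln 10\<close>.\<close>

theorem theorem2:
  shows "i_inf 3 \<le> 454 / 1000"
proof -
  define x where "x = ln (3 :: real)"
  define y where "y = ln (10 :: real)"
  have x: "x > 0" by (simp add: x_def)
  \<comment> \<open>Required is \<open>ln 10 \<ge> 2.092 * ln 3\<close>; comparing
    \<open>3 ^ 44\<close> with \<open>10 ^ 21\<close> gives the factor
    \<open>44 / 21 > 2.095\<close>.\<close>
  have "real 44 * ln 3 = ln ((3 :: real) ^ 44)"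
    by (simp only: ln_realpow)
  also have "\<dots> \<le> ln (10 ^ 21)" by (intro ln_mono) auto
  also have "\<dots> = real 21 * ln 10"
    by (simp only: ln_realpow)
  finally have xy: "44 * x \<le> 21 * y" by (simp add: x_def y_def)
  have "2 * ln (5 / 4 :: real) - 3 * ln (5 / 6) = ln ((5 / 4) ^ 2) - ln ((5 / 6) ^ 3)"
    by (simp add: ln_realpow)
  also have "\<dots> = ln ((5 / 4) ^ 2 / (5 / 6) ^ 3)"
    by (rule ln_divide_pos[symmetric]) auto
  also have "(5 / 4) ^ 2 / (5 / 6) ^ 3 = (3 ^ 3 / 10 :: real)"
    by (simp add: power2_eq_square power3_eq_cube)
  also have "ln \<dots> = ln (3 ^ 3) - ln 10"
    by (rule ln_divide_pos) auto
  also have "\<dots> = 3 * x - y"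
    by (simp only: ln_realpow x_def y_def of_nat_numeral)
  finally have "2 * ln (5 / 4 :: real) - 3 * ln (5 / 6) = 3 * x - y" .
  hence "(ln (5 / 4) - 3 / 2 * ln (5 / 6)) \<le> 454 / 1000 * x"
    using xy x by linarith
  hence "(ln (5 / 4) - 3 / 2 * ln (5 / 6)) / x \<le> 454 / 1000"
    using x by (simp add: pos_divide_le_eq)
  hence "rsb_bound 3 3 (1 / 2) \<le> 454 / 1000"
    by (simp add: rsb_bound_def x_def power2_eq_square power3_eq_cube)
  moreover have "i_inf 3 \<le> rsb_bound 3 3 (1 / 2)"
    by (rule i_inf_le_rsb_bound) auto
  ultimately show ?thesis by linarith
qed

end
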